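(* Let $K\in\mathbb{R}$ and suppose that a compact measured length space $(X,d,\nu)$ has $\infty$-Ricci curvature bounded below by $K$. Suppose that $f\in\mathrm{Lip}(X)$ satisfies $\int_X f^2\,d\nu=1$. (a) If $K>0$ then $$\int_X f^2\log(f^2)\,d\nu\le\frac{2}{K}\int_X|\nabla f|^2\,d\nu.$$ (b) If $K\le0$ then $$\int_X f^2\log(f^2)\,d\nu\le 2\,\mathrm{diam}(X)\sqrt{\int_X|\nabla f|^2\,d\nu}-\frac12K\,\mathrm{diam}(X)^2.$$
   Context: $\mathrm{Lip}(X)$ is the set of real-valued Lipschitz functions on $X$, and $|\nabla f|(x)=\limsup_{y\to x}\frac{|f(y)-f(x)|}{d(x,y)}$ (with value $0$ at isolated points). Convention: $0\log0=0$. A compact measured length space $(X,d,\nu)$ is a compact length space $(X,d)$ (the distance is the infimum of lengths of joining curves) with a Borel probability measure $\nu$. $P_2(X)$ is the set of Borel probability measures on $X$ with the quadratic Wasserstein metric $W_2(\mu_0,\mu_1)^2=\inf_\pi\int d(x_0,x_1)^2\,d\pi$ ($\pi$ ranging over couplings of $\mu_0,\mu_1$). A Wasserstein geodesic $\{\mu_t\}_{t\in[0,1]}$ is a minimizing geodesic of $P_2(X)$, parametrized so that $W_2(\mu_t,\mu_s)=|t-s|W_2(\mu_0,\mu_1)$. For a continuous convex $U:[0,\infty)\to\mathbb{R}$ with $U(0)=0$, put $U'(\infty)=\lim_{r\to\infty}U(r)/r$ and $U_\nu(\mu)=\int_X U(\rho)\,d\nu+U'(\infty)\mu_s(X)\in\mathbb{R}\cup\{\infty\}$,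 where $\mu=\rho\nu+\mu_s$ is the Lebesgue decomposition of $\mu$ with respect to $\nu$ (convention $\infty\cdot0=0$). $\mathcal{DC}_\infty$ is the set of such $U$ for which $\lambda\mapsto e^\lambda U(e^{-\lambda})$ is convex on $\mathbb{R}$. Given $K\in\mathbb{R}$, for $U\in\mathcal{DC}_\infty$ put $p(r)=rU'_+(r)-U(r)$ ($U'_+$ the right derivative) and $\lambda(U)=\inf_{r>0}K\frac{p(r)}{r}\in\mathbb{R}\cup\{-\infty\}$. $(X,d,\nu)$ has $\infty$-Ricci curvature bounded below by $K$ if for all $\mu_0,\mu_1\in P_2(X)$ with supports in $\mathrm{supp}(\nu)$ there is some Wasserstein geodesic $\{\mu_t\}$ from $\mu_0$ to $\mu_1$ such that for all $U\in\mathcal{DC}_\infty$ and $t\in[0,1]$: $U_\nu(\mu_t)\le tU_\nu(\mu_1)+(1-t)U_\nu(\mu_0)-\frac12\lambda(U)t(1-t)W_2(\mu_0,\mu_1)^2$. *)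

theory Defs
  imports "HOL-Probability.Probability"
begin

text \<open>The underlying space X is the whole type \<^typ>\<open>'a\<close> of class \<^class>\<open>metric_space\<close>, with its metric
  \<^const>\<open>dist\<close> and its Borel sigma-algebra \<^const>\<open>borel\<close>.\<close>

definition curve_length :: "(real \<Rightarrow> 'a::metric_space) \<Rightarrow> ennreal" where
  "curve_length \<gamma> =
    (SUP (n, \<tau>) \<in> {(n, \<tau> :: nat \<Rightarrow> real). \<tau> 0 = 0 \<and> \<tau> n = 1 \<and> (\<forall>i<n. \<tau> i \<le> \<tau> (Suc i))}.
       \<Sum>i<n. ennreal (dist (\<gamma> (\<tau> i)) (\<gamma> (\<tau> (Suc i)))))"

text \<open>If no curve joins x and y, the infimum below is \<infinity>; so a length space is path-connected.\<close>

definition length_space :: "'a::metric_space itself \<Rightarrow> bool" where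
  "length_space _ \<longleftrightarrow>
    (\<forall>x y :: 'a. ennreal (dist x y) =
       (INF \<gamma> \<in> {\<gamma>. path \<gamma> \<and> pathstart \<gamma> = x \<and> pathfinish \<gamma> = y}. curve_length \<gamma>))"

definition P2 :: "'a::metric_space measure set" where
  "P2 = {\<mu>. prob_space \<mu> \<and> sets \<mu> = sets borel}"

definition compact_measured_length_space :: "'a::metric_space measure \<Rightarrow> bool" where
  "compact_measured_length_space \<nu> \<longleftrightarrow>
    compact (UNIV :: 'a set) \<and> length_space TYPE('a) \<and> \<nu> \<in> P2"

definition couplings :: "'a::metric_space measure \<Rightarrow> 'a measure \<Rightarrow> ('a \<times> 'a) measure set" where
  "couplings \<mu>\<^sub>0 \<mu>\<^sub>1 = {\<pi>. sets \<pi> = sets borel \<and> distr \<pi> borel fst = \<mu>\<^sub>0 \<and> distr \<pi> borel snd = \<mu>\<^sub>1}"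

text \<open>For measures in \<^const>\<open>P2\<close> on a compact space the infimum is finite, so \<^const>\<open>enn2real\<close> loses
  nothing.\<close>

definition W2 :: "'a::metric_space measure \<Rightarrow> 'a measure \<Rightarrow> real" where
  "W2 \<mu>\<^sub>0 \<mu>\<^sub>1 = sqrt (enn2real
    (INF \<pi> \<in> couplings \<mu>\<^sub>0 \<mu>\<^sub>1. \<integral>\<^sup>+ z. ennreal ((dist (fst z) (snd z))\<^sup>2) \<partial>\<pi>))"

definition wasserstein_geodesic ::
  "'a::metric_space measure \<Rightarrow> 'a measure \<Rightarrow> (real \<Rightarrow> 'a measure) \<Rightarrow> bool" where
  "wasserstein_geodesic \<mu>\<^sub>0 \<mu>\<^sub>1 \<mu> \<longleftrightarrow>
    (\<forall>t\<in>{0..1}. \<mu> t \<in> P2) \<and> \<mu> 0 = \<mu>\<^sub>0 \<and> \<mu> 1 = \<mu>\<^sub>1 \<and>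
    (\<forall>s\<in>{0..1}. \<forall>t\<in>{0..1}. W2 (\<mu> t) (\<mu> s) = \<bar>t - s\<bar> * W2 \<mu>\<^sub>0 \<mu>\<^sub>1)"

definition msupport :: "'a::metric_space measure \<Rightarrow> 'a set" where
  "msupport \<mu> = {x. \<forall>S. open S \<longrightarrow> x \<in> S \<longrightarrow> 0 < emeasure \<mu> S}"

text \<open>The decomposition \<mu> = \<rho>\<nu> + \<sigma> with \<sigma> singular with respect to \<nu>.\<close>

definition lebesgue_decomposition ::
  "'a measure \<Rightarrow> 'a measure \<Rightarrow> ('a \<Rightarrow> real) \<Rightarrow> 'a measure \<Rightarrow> bool" where
  "lebesgue_decomposition \<nu> \<mu> \<rho> \<sigma> \<longleftrightarrow>
    \<rho> \<in> borel_measurable \<nu> \<and> (\<forall>x. 0 \<le> \<rho> x) \<and> sets \<sigma> = sets \<nu> \<and>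
    (\<exists>N\<in>null_sets \<nu>. emeasure \<sigma> (space \<nu> - N) = 0) \<and>
    (\<forall>A\<in>sets \<nu>. emeasure \<mu> A = emeasure (density \<nu> (\<lambda>x. ennreal (\<rho> x))) A + emeasure \<sigma> A)"

text \<open>Functions on \<open>[0,\<infinity>)\<close> are represented by total functions on the reals; their values at negative
  arguments are never used.\<close>

definition slope_at_infinity :: "(real \<Rightarrow> real) \<Rightarrow> ereal" where
  "slope_at_infinity U = Lim at_top (\<lambda>r. ereal (U r / r))"

text \<open>The integral of \<^term>\<open>U \<circ> \<rho>\<close> is taken as an \<^typ>\<open>ereal\<close>, the difference of the integrals of the
  positive and of the negative part (\<^const>\<open>ennreal\<close> maps negative reals to 0); the latter is finite
  because U is bounded below by an affine function. The choice of the decomposition is immaterial,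
  as \<sigma> is unique and \<rho> is unique almost everywhere.\<close>

definition U_functional :: "'a measure \<Rightarrow> (real \<Rightarrow> real) \<Rightarrow> 'a measure \<Rightarrow> ereal" where
  "U_functional \<nu> U \<mu> =
    (let (\<rho>, \<sigma>) = (SOME q. lebesgue_decomposition \<nu> \<mu> (fst q) (snd q)) in
       enn2ereal (\<integral>\<^sup>+ x. ennreal (U (\<rho> x)) \<partial>\<nu>) - enn2ereal (\<integral>\<^sup>+ x. ennreal (- U (\<rho> x)) \<partial>\<nu>)
       + slope_at_infinity U * enn2ereal (emeasure \<sigma> (space \<sigma>)))"

definition DC_infinity :: "(real \<Rightarrow> real) set" where
  "DC_infinity = {U. continuous_on {0..} U \<and> convex_on {0..} U \<and> U 0 = 0 \<and>
     convex_on UNIV (\<lambda>l. exp l * U (exp (- l)))}"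

definition right_deriv :: "(real \<Rightarrow> real) \<Rightarrow> real \<Rightarrow> real" where
  "right_deriv U r = Lim (at_right r) (\<lambda>s. (U s - U r) / (s - r))"

definition pressure :: "(real \<Rightarrow> real) \<Rightarrow> real \<Rightarrow> real" where
  "pressure U r = r * right_deriv U r - U r"

definition lambda_K :: "real \<Rightarrow> (real \<Rightarrow> real) \<Rightarrow> ereal" where
  "lambda_K K U = (INF r \<in> {0<..}. ereal (K * (pressure U r / r)))"

text \<open>The inequality is one of extended reals, where \<open>0 * \<infinity> = 0\<close>; no term \<open>\<infinity> - \<infinity>\<close> arises, since
  \<^const>\<open>U_functional\<close> is never \<open>-\<infinity>\<close> and \<^const>\<open>lambda_K\<close> is never \<open>\<infinity>\<close>.\<close>

definition infinity_Ricci_bounded_below :: "'a::metric_space measure \<Rightarrow> real \<Rightarrow> bool" where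
  "infinity_Ricci_bounded_below \<nu> K \<longleftrightarrow>
    (\<forall>\<mu>\<^sub>0\<in>P2. \<forall>\<mu>\<^sub>1\<in>P2. msupport \<mu>\<^sub>0 \<subseteq> msupport \<nu> \<longrightarrow> msupport \<mu>\<^sub>1 \<subseteq> msupport \<nu> \<longrightarrow>
      (\<exists>\<mu>. wasserstein_geodesic \<mu>\<^sub>0 \<mu>\<^sub>1 \<mu> \<and>
        (\<forall>U\<in>DC_infinity. \<forall>t\<in>{0..1}.
          U_functional \<nu> U (\<mu> t) \<le>
            ereal t * U_functional \<nu> U \<mu>\<^sub>1 + ereal (1 - t) * U_functional \<nu> U \<mu>\<^sub>0
            - lambda_K K U * ereal (1/2 * t * (1 - t) * (W2 \<mu>\<^sub>0 \<mu>\<^sub>1)\<^sup>2))))"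

definition Lip :: "('a::metric_space \<Rightarrow> real) set" where
  "Lip = {f. \<exists>L. L-lipschitz_on UNIV f}"

text \<open>\<^term>\<open>at x = bot\<close> says that x is isolated. For Lipschitz f the limit superior is finite.\<close>

definition grad_norm :: "('a::metric_space \<Rightarrow> real) \<Rightarrow> 'a \<Rightarrow> real" where
  "grad_norm f x =
    (if at x = bot then 0
     else real_of_ereal (Limsup (at x) (\<lambda>y. ereal (\<bar>f y - f x\<bar> / dist x y))))"

end

theory Submission
  imports Defs
begin

text \<open>Let \<open>\<rho> = exp \<phi>\<close> be a positive Lipschitz density and \<open>\<mu> t\<close> the geodesic from \<open>\<rho>\<nu>\<close> to \<open>\<nu>\<close> along
  which the entropy is \<open>K\<close>-convex. The Gibbs variational inequality bounds the entropy of \<open>\<mu> t\<close> from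
  below by \<open>\<integral> \<phi> d\<mu>\<^sub>t\<close>, with equality at \<open>t = 0\<close>, so convexity gives, with \<open>H\<close> the entropy of \<open>\<rho>\<nu>\<close>
  and \<open>W = W2 (\<rho>\<nu>) \<nu>\<close>,
  \<open>t H \<le> \<integral> \<phi> d\<mu>\<^sub>0 - \<integral> \<phi> d\<mu>\<^sub>t - K t (1 - t) W\<^sup>2 / 2\<close>.
  Estimate the difference of the integrals through an almost optimal coupling of \<open>\<mu>\<^sub>0\<close> and \<open>\<mu>\<^sub>t\<close>,
  whose cost is about \<open>t\<^sup>2 W\<^sup>2\<close>, and Young's inequality; letting \<open>t\<close> tend to 0 yields
  \<open>H \<le> (a / 2) \<integral> |grad \<phi>|\<^sup>2 \<rho> d\<nu> + (1 / a - K) W\<^sup>2 / 2\<close> for every \<open>a > 0\<close>. Apply this to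
  \<open>\<rho> = (f\<^sup>2 + \<epsilon>) / (1 + \<epsilon>)\<close>, for which \<open>|grad \<phi>|\<^sup>2 \<rho> \<le> 4 |grad f|\<^sup>2\<close>, let \<open>\<epsilon>\<close> tend to 0, and take
  \<open>a = 1 / K\<close> if \<open>K > 0\<close>, or bound \<open>W\<close> by the diameter and optimise over \<open>a\<close> if \<open>K \<le> 0\<close>.\<close>

section \<open>Entropy\<close>

text \<open>At 0 the value is \<open>0 * ln 0 = 0\<close>, whatever the default value of
  \<open>ln 0\<close>, in agreement with the convention for the entropy.\<close>

definition ent :: "real \<Rightarrow> real" where "ent r = r * ln r"

text \<open>This is \<open>ln z \<le> z - 1\<close> at \<open>z = r / s\<close>, multiplied by
  \<open>s\<close>. Besides convexity it yields the Gibbs inequality, by taking \<open>r\<close> to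
  be the density \<open>exp (\<phi> x)\<close>.\<close>

lemma ent_supporting_line:
  assumes "0 < r" "0 \<le> s"
  shows "ent r + (1 + ln r) * (s - r) \<le> ent s"
proof (cases "s = 0")
  case True
  then show ?thesis using assms by (simp add: ent_def algebra_simps)
next
  case False
  then have s: "s > 0" using assms by simp
  have "ln (r / s) \<le> r / s - 1" using assms s by (intro ln_le_minus_one) auto
  then have "s * (ln r - ln s) \<le> s * (r / s - 1)"
    using assms s by (intro mult_left_mono) (auto simp: ln_div)
  then show ?thesis using s by (simp add: ent_def algebra_simps)
qed

lemma ent_ge_minus_one: "0 \<le> s \<Longrightarrow> s - 1 \<le> ent s"
  using ent_supporting_line[of 1 s] by (simp add: ent_def)

lemma continuous_on_ent: "continuous_on {0..} ent"
proof -
  have "((\<lambda>r::real. r * ln r) \<longlongrightarrow> 0) (at_right 0)" by real_asymp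
  then have "(ent \<longlongrightarrow> ent 0) (at 0 within {0..})"
    by (simp add: ent_def[abs_def] at_within_Ici_at_right)
  moreover have "(ent \<longlongrightarrow> ent x) (at x within {0..})" if "x > 0" for x
    unfolding ent_def[abs_def] using that by (auto intro!: tendsto_intros)
  ultimately show ?thesis
    unfolding continuous_on_def by (metis atLeast_iff order_le_less)
qed

lemma convex_on_ent: "convex_on {0..} ent"
proof (intro convex_onI)
  fix t x y :: real
  assume t: "0 < t" "t < 1" and xy: "x \<in> {0..}" "y \<in> {0..}"
  define r where "r = (1 - t) * x + t * y"
  have "ent r \<le> (1 - t) * ent x + t * ent y"
  proof (cases "r = 0")
    case True
    then have "(1 - t) * x = 0" "t * y = 0"
      using t xy by (auto simp: r_def add_nonneg_eq_0_iff)
    then have "x = 0" "y = 0" using t by auto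
    then show ?thesis by (simp add: r_def ent_def)
  next
    case False
    moreover have "r \<ge> 0" using t xy by (simp add: r_def)
    ultimately have r: "r > 0" by simp
    \<comment> \<open>Average the supporting lines at the intermediate point \<open>r\<close>; their
      linear terms cancel.\<close>
    have "(1 - t) * (ent r + (1 + ln r) * (x - r)) + t * (ent r + (1 + ln r) * (y - r))
        \<le> (1 - t) * ent x + t * ent y"
      using t xy r by (intro add_mono mult_left_mono ent_supporting_line) auto
    moreover have "(1 - t) * (ent r + (1 + ln r) * (x - r)) + t * (ent r + (1 + ln r) * (y - r))
       = ent r + (1 + ln r) * ((1 - t) * x + t * y - r)" by (simp add: algebra_simps)
    ultimately show ?thesis by (simp add: r_def)
  qed
  then show "ent ((1 - t) *\<^sub>R x + t *\<^sub>R y) \<le> (1 - t) * ent x + t * ent y"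
    by (simp add: r_def)
qed auto

text \<open>The entropy is the borderline member of the class: its function in the last condition is
  the linear function \<open>-l\<close>.\<close>

lemma ent_in_DC_infinity: "ent \<in> DC_infinity"
proof -
  have eq: "(\<lambda>l. exp l * ent (exp (- l))) = (\<lambda>l. - l)"
    by (auto simp: ent_def fun_eq_iff mult.assoc[symmetric] exp_minus_inverse)
  have "convex_on UNIV (\<lambda>l::real. - l)"
    by (intro convex_onI) (auto simp: algebra_simps)
  then show ?thesis
    using continuous_on_ent convex_on_ent unfolding DC_infinity_def by (simp add: eq) (simp add: ent_def)
qed

text \<open>Since the pressure is linear, the infimum in \<open>lambda_K\<close> runs over the
  constant \<open>K\<close>, so the entropy is convex with modulus exactly \<open>K\<close>.\<close>

lemma pressure_ent:
  assumes "r > 0"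
  shows "pressure ent r = r"
proof -
  have "(ent has_real_derivative (1 + ln r)) (at r)"
    unfolding ent_def[abs_def] using assms by (auto intro!: derivative_eq_intros)
  then have "((\<lambda>s. (ent s - ent r) / (s - r)) \<longlongrightarrow> 1 + ln r) (at_right r)"
    unfolding has_field_derivative_iff by (rule filterlim_mono) (auto simp: at_le)
  then have "right_deriv ent r = 1 + ln r"
    unfolding right_deriv_def by (intro tendsto_Lim) auto
  then show ?thesis by (simp add: pressure_def ent_def algebra_simps)
qed

lemma lambda_K_ent: "lambda_K K ent = ereal K"
  unfolding lambda_K_def by (rule INF_eq_const) (auto simp: pressure_ent)

text \<open>The infinite slope makes every singular part cost infinite entropy, which
  \<open>integral_le_relative_entropy\<close> exploits.\<close>

lemma slope_at_infinity_ent: "slope_at_infinity ent = \<infinity>"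
proof -
  have "((\<lambda>r. ereal (ln r)) \<longlongrightarrow> \<infinity>) at_top"
    by (intro tendsto_PInfty_eq_at_top[THEN iffD2] ln_at_top)
  moreover have "eventually (\<lambda>r. ereal (ln r) = ereal (ent r / r)) at_top"
    using eventually_gt_at_top[of 0] by eventually_elim (simp add: ent_def)
  ultimately have "((\<lambda>r. ereal (ent r / r)) \<longlongrightarrow> \<infinity>) at_top"
    by (rule Lim_transform_eventually)
  then show ?thesis unfolding slope_at_infinity_def by (intro tendsto_Lim) auto
qed

section \<open>Local slopes\<close>

text \<open>The centre \<open>y = x\<close> contributes the value \<open>0 / 0 = 0\<close>, so the supremum is never over the empty
  set and is 0 at isolated points for small \<open>\<delta>\<close>.\<close>

definition local_slope :: "real \<Rightarrow> ('a::metric_space \<Rightarrow> real) \<Rightarrow> 'a \<Rightarrow> real" where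
  "local_slope \<delta> f x = (SUP y\<in>ball x \<delta>. \<bar>f y - f x\<bar> / dist x y)"

lemma lipschitz_quotient_le:
  fixes f :: "'a::metric_space \<Rightarrow> real"
  assumes "L-lipschitz_on UNIV f"
  shows "\<bar>f y - f x\<bar> / dist x y \<le> L"
proof (cases "x = y")
  case True
  then show ?thesis using lipschitz_on_nonneg[OF assms] by simp
next
  case False
  then show ?thesis
    using lipschitz_onD[OF assms, of x y] by (simp add: dist_real_def divide_le_eq abs_minus_commute)
qed

lemma bdd_above_lipschitz_quotient:
  fixes f :: "'a::metric_space \<Rightarrow> real"
  assumes "L-lipschitz_on UNIV f"
  shows "bdd_above ((\<lambda>y. \<bar>f y - f x\<bar> / dist x y) ` S)"
  using lipschitz_quotient_le[OF assms] by (auto intro!: bdd_aboveI2)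

lemma quotient_le_local_slope:
  assumes "L-lipschitz_on UNIV f" "dist x y < \<delta>"
  shows "\<bar>f y - f x\<bar> / dist x y \<le> local_slope \<delta> f x"
  unfolding local_slope_def using assms
  by (intro cSUP_upper bdd_above_lipschitz_quotient) auto

lemma local_slope_le:
  assumes "0 < \<delta>" "\<And>y. dist x y < \<delta> \<Longrightarrow> \<bar>f y - f x\<bar> / dist x y \<le> c"
  shows "local_slope \<delta> f x \<le> c"
  unfolding local_slope_def using assms by (intro cSUP_least) auto

lemma local_slope_nonneg:
  assumes "L-lipschitz_on UNIV f" "0 < \<delta>"
  shows "0 \<le> local_slope \<delta> f x"
  using quotient_le_local_slope[OF assms(1), of x x \<delta>] assms(2) by simp

lemma local_slope_le_lipschitz:
  assumes "L-lipschitz_on UNIV f" "0 < \<delta>"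
  shows "local_slope \<delta> f x \<le> L"
  using assms by (intro local_slope_le lipschitz_quotient_le)

lemma local_slope_mono:
  assumes "L-lipschitz_on UNIV f" "0 < \<delta>" "\<delta> \<le> \<delta>'"
  shows "local_slope \<delta> f x \<le> local_slope \<delta>' f x"
  using assms by (intro local_slope_le quotient_le_local_slope) auto

text \<open>The slope is lower semicontinuous: each superlevel set is a union over \<open>y\<close>
  of sets of \<open>x\<close> that are open because \<open>f\<close> is continuous. The union may be
  uncountable, being a union of open sets.\<close>

lemma borel_measurable_local_slope:
  fixes f :: "'a::metric_space \<Rightarrow> real"
  assumes L: "L-lipschitz_on UNIV f" and "0 < \<delta>"
  shows "local_slope \<delta> f \<in> borel_measurable borel"
proof (rule borel_measurableI_greater)
  fix a :: real
  have cf: "continuous_on UNIV f" using L by (rule lipschitz_on_continuous_on)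
  have "open {x. a < local_slope \<delta> f x}"
  proof (cases "a < 0")
    case True
    then have "{x. a < local_slope \<delta> f x} = UNIV"
      using local_slope_nonneg[OF assms] by (auto intro: less_le_trans)
    then show ?thesis by simp
  next
    case False
    \<comment> \<open>For \<open>a \<ge> 0\<close> the division can be cleared even at
      \<open>y = x\<close>, where both strict inequalities fail.\<close>
    have "a < local_slope \<delta> f x \<longleftrightarrow> (\<exists>y. dist x y < \<delta> \<and> a * dist x y < \<bar>f y - f x\<bar>)" for x
    proof -
      have "a < local_slope \<delta> f x \<longleftrightarrow> (\<exists>y\<in>ball x \<delta>. a < \<bar>f y - f x\<bar> / dist x y)"
        unfolding local_slope_def using \<open>0 < \<delta>\<close>
        by (intro less_cSUP_iff bdd_above_lipschitz_quotient[OF L]) auto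
      also have "\<dots> \<longleftrightarrow> (\<exists>y. dist x y < \<delta> \<and> a * dist x y < \<bar>f y - f x\<bar>)"
      proof -
        have "a < \<bar>f y - f x\<bar> / dist x y \<longleftrightarrow> a * dist x y < \<bar>f y - f x\<bar>" for y
          using False by (cases "x = y") (auto simp: less_divide_eq)
        then show ?thesis by auto
      qed
      finally show ?thesis .
    qed
    then have "{x. a < local_slope \<delta> f x}
        = (\<Union>y. {x. dist x y < \<delta>} \<inter> {x. a * dist x y < \<bar>f y - f x\<bar>})" by auto
    moreover have "open \<dots>"
      by (intro open_UN ballI open_Int open_Collect_less continuous_intros cf)
    ultimately show ?thesis by simp
  qed
  then show "{x \<in> space borel. a < local_slope \<delta> f x} \<in> sets borel" by simp
qed

text \<open>The last two clauses identify \<open>grad_norm f x\<close> as the infimum of the slopes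
  over all radii, at isolated points as well. This replaces the limit superior in everything that
  follows.\<close>

lemma grad_norm_bounds:
  fixes f :: "'a::metric_space \<Rightarrow> real"
  assumes L: "L-lipschitz_on UNIV f"
  shows "0 \<le> grad_norm f x"
    and "0 < \<delta> \<Longrightarrow> grad_norm f x \<le> local_slope \<delta> f x"
    and "grad_norm f x < c \<Longrightarrow> \<exists>\<delta>>0. local_slope \<delta> f x \<le> c"
proof -
  define q where "q y = \<bar>f y - f x\<bar> / dist x y" for y
  define l where "l = Limsup (at x) (\<lambda>y. ereal (q y))"
  have 1: "0 \<le> l" "l \<le> ereal (local_slope \<delta> f x)" if "at x \<noteq> bot" "0 < \<delta>" for \<delta>
  proof -
    have "0 \<le> Liminf (at x) (\<lambda>y. ereal (q y))"
      unfolding q_def by (intro Liminf_bounded) auto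
    also have "\<dots> \<le> l" unfolding l_def using that by (intro Liminf_le_Limsup)
    finally show "0 \<le> l" .
    have "eventually (\<lambda>y. dist x y < \<delta>) (at x)"
      using that by (auto simp: eventually_at dist_commute)
    then have "eventually (\<lambda>y. ereal (q y) \<le> ereal (local_slope \<delta> f x)) (at x)"
      unfolding q_def
      by eventually_elim (auto intro!: quotient_le_local_slope[OF L])
    then show "l \<le> ereal (local_slope \<delta> f x)" unfolding l_def by (rule Limsup_bounded)
  qed
  have g: "grad_norm f x = (if at x = bot then 0 else real_of_ereal l)"
    by (simp add: grad_norm_def l_def q_def)
  \<comment> \<open>The limit superior lies between 0 and a real number, so
    \<open>real_of_ereal\<close> does not fall back on its default value.\<close>
  have 2: "l = ereal (grad_norm f x)" if "at x \<noteq> bot"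
    using 1[OF that, of 1] that by (cases l) (auto simp: g)
  show 3: "0 \<le> grad_norm f x"
    using 1(1)[of 1] by (auto simp: g real_of_ereal_pos)
  show "grad_norm f x \<le> local_slope \<delta> f x" if "0 < \<delta>"
  proof (cases "at x = bot")
    case True
    then show ?thesis using local_slope_nonneg[OF L that] by (simp add: g)
  next
    case False
    then show ?thesis using 1(2)[OF False that] 2[OF False] by simp
  qed
  show "\<exists>\<delta>>0. local_slope \<delta> f x \<le> c" if c: "grad_norm f x < c"
  proof -
    have "eventually (\<lambda>y. q y \<le> c) (at x)"
    proof (cases "at x = bot")
      case False
      then have "Limsup (at x) (\<lambda>y. ereal (q y)) < ereal c" using 2 c by (simp add: l_def)
      then have "eventually (\<lambda>y. ereal (q y) < ereal c) (at x)" by (rule Limsup_lessD)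
      then show ?thesis by eventually_elim auto
    qed simp
    then obtain d where d: "d > 0" "\<And>y. y \<noteq> x \<Longrightarrow> dist y x < d \<Longrightarrow> q y \<le> c"
      by (auto simp: eventually_at)
    \<comment> \<open>The centre \<open>y = x\<close>, missing from the punctured filter, is covered
      because \<open>q x = 0\<close> and \<open>c\<close> exceeds the nonnegative gradient
      norm.\<close>
    have "q y \<le> c" if "dist x y < d" for y
      using d(2)[of y] that 3 c by (cases "y = x") (auto simp: q_def dist_commute)
    then show ?thesis using d(1) by (auto simp: q_def intro!: exI[of _ d] local_slope_le)
  qed
qed

lemma tendsto_local_slope:
  fixes f :: "'a::metric_space \<Rightarrow> real"
  assumes L: "L-lipschitz_on UNIV f"
  shows "((\<lambda>\<delta>. local_slope \<delta> f x) \<longlongrightarrow> grad_norm f x) (at_right 0)"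
proof (rule order_tendstoI)
  fix a assume a: "a < grad_norm f x"
  show "\<forall>\<^sub>F \<delta> in at_right 0. a < local_slope \<delta> f x"
    using eventually_at_right_less[of 0]
    by eventually_elim (use a grad_norm_bounds(2)[OF L] in \<open>auto intro: less_le_trans\<close>)
next
  fix a assume "grad_norm f x < a"
  then obtain c where c: "grad_norm f x < c" "c < a" using dense by blast
  obtain \<delta>' where d: "\<delta>' > 0" "local_slope \<delta>' f x \<le> c" using grad_norm_bounds(3)[OF L c(1)] by auto
  have "\<forall>\<^sub>F \<delta> in at_right 0. \<delta> < \<delta>' \<and> 0 < \<delta>"
    using d(1) by (auto simp: eventually_at_right)
  then show "\<forall>\<^sub>F \<delta> in at_right 0. local_slope \<delta> f x < a"
  proof eventually_elim
    case (elim \<delta>)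
    then have "local_slope \<delta> f x \<le> local_slope \<delta>' f x" by (intro local_slope_mono[OF L]) auto
    then show ?case using d c by simp
  qed
qed

text \<open>A sequence of radii gives measurability of the limit and access to dominated
  convergence.\<close>

lemma tendsto_local_slope_seq:
  fixes f :: "'a::metric_space \<Rightarrow> real"
  assumes L: "L-lipschitz_on UNIV f"
  shows "(\<lambda>n. local_slope (1 / Suc n) f x) \<longlonglongrightarrow> grad_norm f x"
proof (rule filterlim_compose[OF tendsto_local_slope[OF L]])
  show "filterlim (\<lambda>n. 1 / real (Suc n)) (at_right 0) sequentially"
    unfolding filterlim_at using lim_inverse_n' LIMSEQ_Suc[OF lim_inverse_n'] by (auto simp: )
qed

lemma borel_measurable_grad_norm:
  fixes f :: "'a::metric_space \<Rightarrow> real"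
  assumes "L-lipschitz_on UNIV f"
  shows "grad_norm f \<in> borel_measurable borel"
  by (rule borel_measurable_LIMSEQ_real[OF tendsto_local_slope_seq[OF assms]
        borel_measurable_local_slope[OF assms]]) simp

lemma grad_norm_le_lipschitz:
  assumes "L-lipschitz_on UNIV f"
  shows "grad_norm f x \<le> L"
  using grad_norm_bounds(2)[OF assms, of 1] local_slope_le_lipschitz[OF assms, of 1]
  by (meson order_trans zero_less_one)

text \<open>A chain rule at the single point \<open>x\<close>: \<open>c\<close> plays the role of
  the derivative of the outer function, and the error \<open>C * dist x y\<close> is at most
  \<open>C * \<delta>\<close> on the ball, hence disappears as the radius shrinks.\<close>

lemma grad_norm_chain:
  fixes f g :: "'a::metric_space \<Rightarrow> real"
  assumes f: "L-lipschitz_on UNIV f" and g: "M-lipschitz_on UNIV g"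
    and "0 \<le> c" "0 \<le> C"
    and le: "\<And>y. \<bar>g y - g x\<bar> \<le> (c + C * dist x y) * \<bar>f y - f x\<bar>"
  shows "grad_norm g x \<le> c * grad_norm f x"
proof (rule tendsto_le[OF trivial_limit_at_right_real])
  show "((\<lambda>\<delta>. local_slope \<delta> g x) \<longlongrightarrow> grad_norm g x) (at_right 0)"
    by (rule tendsto_local_slope[OF g])
  have "((\<lambda>\<delta>. (c + C * \<delta>) * local_slope \<delta> f x) \<longlongrightarrow> (c + C * 0) * grad_norm f x) (at_right 0)"
    by (intro tendsto_intros tendsto_local_slope[OF f])
  then show "((\<lambda>\<delta>. (c + C * \<delta>) * local_slope \<delta> f x) \<longlongrightarrow> c * grad_norm f x) (at_right 0)"
    by simp
  show "\<forall>\<^sub>F \<delta> in at_right 0. local_slope \<delta> g x \<le> (c + C * \<delta>) * local_slope \<delta> f x"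
    using eventually_at_right_less[of "0::real"]
  proof eventually_elim
    case (elim \<delta>)
    show ?case
    proof (rule local_slope_le[OF elim])
      fix y assume y: "dist x y < \<delta>"
      have "\<bar>g y - g x\<bar> / dist x y \<le> (c + C * dist x y) * \<bar>f y - f x\<bar> / dist x y"
        by (intro divide_right_mono le) simp
      also have "\<dots> = (c + C * dist x y) * (\<bar>f y - f x\<bar> / dist x y)" by simp
      also have "\<dots> \<le> (c + C * \<delta>) * local_slope \<delta> f x"
        using y assms(3,4) elim
        by (intro mult_mono quotient_le_local_slope[OF f] add_left_mono mult_left_mono) auto
      finally show "\<bar>g y - g x\<bar> / dist x y \<le> (c + C * \<delta>) * local_slope \<delta> f x" .
    qed
  qed
qed

section \<open>Lebesgue decomposition\<close>

text \<open>Needed because \<open>U_functional\<close> selects its decomposition with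
  \<open>SOME\<close>. Outside a null set of maximal \<open>\<mu>\<close>-measure,
  \<open>\<mu>\<close> is absolutely continuous and has a Radon-Nikodym derivative.\<close>

lemma lebesgue_decomposition_exists:
  assumes "finite_measure \<nu>" "finite_measure \<mu>" and sets: "sets \<mu> = sets \<nu>"
  shows "\<exists>\<rho> \<sigma>. lebesgue_decomposition \<nu> \<mu> \<rho> \<sigma>"
proof -
  interpret \<nu>: finite_measure \<nu> by fact
  interpret \<mu>: finite_measure \<mu> by fact
  \<comment> \<open>The singular part is the restriction of \<open>\<mu>\<close> to a \<open>\<nu>\<close>-null set of maximal \<open>\<mu>\<close>-measure.\<close>
  define s where "s = (SUP N\<in>null_sets \<nu>. emeasure \<mu> N)"
  have "null_sets \<nu> \<noteq> {}" by auto
  from ennreal_SUP_countable_SUP[OF this, of "emeasure \<mu>"]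
  obtain g :: "nat \<Rightarrow> ennreal" where g: "range g \<subseteq> emeasure \<mu> ` null_sets \<nu>" "s = (SUP i. g i)"
    unfolding s_def by auto
  then have "\<forall>i. \<exists>N\<in>null_sets \<nu>. g i = emeasure \<mu> N" by auto
  then obtain F where F: "\<And>i. F i \<in> null_sets \<nu>" "\<And>i. g i = emeasure \<mu> (F i)" by metis
  define N where "N = (\<Union>i. F i)"
  have N: "N \<in> null_sets \<nu>" unfolding N_def using F by (intro null_sets_UN) auto
  have [measurable]: "N \<in> sets \<nu>" "N \<in> sets \<mu>" using N sets by auto
  have Fs: "F i \<in> sets \<mu>" for i using F(1)[of i] sets by auto
  have "s \<le> emeasure \<mu> N"
    unfolding g(2) F(2) N_def using Fs by (intro SUP_least emeasure_mono) auto
  define \<mu>' where "\<mu>' = density \<mu> (indicator (space \<mu> - N))"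
  define \<sigma> where "\<sigma> = density \<mu> (indicator N)"
  have m': "emeasure \<mu>' A = emeasure \<mu> (A - N)" if "A \<in> sets \<mu>" for A
  proof -
    have "emeasure \<mu>' A = emeasure \<mu> ((space \<mu> - N) \<inter> A)"
      unfolding \<mu>'_def using that by (subst emeasure_restricted) auto
    also have "(space \<mu> - N) \<inter> A = A - N" using sets.sets_into_space[OF that] by auto
    finally show ?thesis .
  qed
  have s: "emeasure \<sigma> A = emeasure \<mu> (N \<inter> A)" if "A \<in> sets \<mu>" for A
    unfolding \<sigma>_def using that by (subst emeasure_restricted) auto
  have sp: "space \<mu> = space \<nu>" using sets by (rule sets_eq_imp_space_eq)
  have ac: "absolutely_continuous \<nu> \<mu>'"
  proof (unfold absolutely_continuous_def, safe)
    fix A assume A: "A \<in> null_sets \<nu>"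
    then have Am: "A \<in> sets \<mu>" using sets by auto
    \<comment> \<open>By maximality, enlarging \<open>N\<close> by \<open>A\<close> cannot increase
      the \<open>\<mu>\<close>-measure; as \<open>\<mu>\<close> is finite, the measure of
      \<open>N\<close> cancels.\<close>
    have "A \<union> N \<in> null_sets \<nu>" using A N by auto
    then have "emeasure \<mu> (A \<union> N) \<le> s" unfolding s_def by (rule SUP_upper)
    also have "A \<union> N = (A - N) \<union> N" by auto
    also have "emeasure \<mu> \<dots> = emeasure \<mu> (A - N) + emeasure \<mu> N"
      using Am by (intro plus_emeasure[symmetric]) auto
    finally have "emeasure \<mu> N + emeasure \<mu> (A - N) \<le> emeasure \<mu> N + 0"
      using order_trans[OF _ \<open>s \<le> emeasure \<mu> N\<close>] by (simp add: add.commute)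
    then have "emeasure \<mu> (A - N) = 0"
      unfolding ennreal_add_left_cancel_le using \<mu>.emeasure_finite[of N] by simp
    then show "A \<in> null_sets \<mu>'" using m'[OF Am] Am by (auto simp: \<mu>'_def)
  qed
  have sets': "sets \<mu>' = sets \<nu>" by (simp add: \<mu>'_def sets)
  have fin: "finite_measure \<mu>'"
    by (intro finite_measureI) (simp add: m' \<mu>'_def[THEN arg_cong[where f=space]])
  obtain \<rho> where \<rho>: "\<rho> \<in> borel_measurable \<nu>" "AE x in \<nu>. RN_deriv \<nu> \<mu>' x = ennreal (\<rho> x)" "\<And>x. 0 \<le> \<rho> x"
    using \<nu>.real_RN_deriv[OF fin ac sets'] by metis
  have "density \<nu> (\<lambda>x. ennreal (\<rho> x)) = density \<nu> (RN_deriv \<nu> \<mu>')"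
    using \<rho> by (intro density_cong) auto
  also have "\<dots> = \<mu>'"
    using ac sets by (intro \<nu>.density_RN_deriv) (auto simp: \<mu>'_def)
  finally have d: "density \<nu> (\<lambda>x. ennreal (\<rho> x)) = \<mu>'" .
  have "lebesgue_decomposition \<nu> \<mu> \<rho> \<sigma>"
    unfolding lebesgue_decomposition_def d
  proof (intro conjI ballI bexI[of _ N] allI)
    show "sets \<sigma> = sets \<nu>" by (simp add: \<sigma>_def sets)
    have "N \<inter> (space \<nu> - N) = {}" by auto
    then show "emeasure \<sigma> (space \<nu> - N) = 0" using sp sets by (subst s) auto
    fix A assume "A \<in> sets \<nu>"
    then have A: "A \<in> sets \<mu>" using sets by simp
    have "emeasure \<mu> A = emeasure \<mu> ((A - N) \<union> (N \<inter> A))" by (rule arg_cong[where f="emeasure \<mu>"]) auto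
    also have "\<dots> = emeasure \<mu> (A - N) + emeasure \<mu> (N \<inter> A)"
      using A by (intro plus_emeasure[symmetric]) auto
    finally show "emeasure \<mu> A = emeasure \<mu>' A + emeasure \<sigma> A" using A by (simp add: m' s)
  qed (use \<rho> N in auto)
  then show ?thesis by blast
qed

lemma lebesgue_decomposition_no_singular_part:
  assumes dec: "lebesgue_decomposition \<nu> \<mu> \<rho> \<sigma>" and sets: "sets \<mu> = sets \<nu>"
    and "emeasure \<sigma> (space \<sigma>) = 0"
  shows "\<mu> = density \<nu> (\<lambda>x. ennreal (\<rho> x))"
proof (rule measure_eqI)
  fix A assume A: "A \<in> sets \<mu>"
  have "emeasure \<sigma> A \<le> emeasure \<sigma> (space \<sigma>)" by (rule emeasure_space)
  then show "emeasure \<mu> A = emeasure (density \<nu> (\<lambda>x. ennreal (\<rho> x))) A"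
    using dec A assms(3) by (simp add: lebesgue_decomposition_def sets)
qed (simp add: sets)

text \<open>Uniqueness when \<open>\<mu>\<close> has a density: the \<open>\<nu>\<close>-null set
  carrying \<open>\<sigma>\<close> is \<open>\<mu>\<close>-null, hence \<open>\<sigma>\<close>-null,
  so \<open>\<sigma>\<close> vanishes. The densities then agree almost everywhere.\<close>

lemma lebesgue_decomposition_density:
  assumes "finite_measure \<nu>" "\<rho> \<in> borel_measurable \<nu>" "\<And>x. 0 \<le> \<rho> x"
    and dec: "lebesgue_decomposition \<nu> (density \<nu> (\<lambda>x. ennreal (\<rho> x))) \<rho>' \<sigma>"
  shows "AE x in \<nu>. \<rho>' x = \<rho> x" and "emeasure \<sigma> (space \<sigma>) = 0"
proof -
  interpret \<nu>: finite_measure \<nu> by fact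
  let ?\<mu> = "density \<nu> (\<lambda>x. ennreal (\<rho> x))"
  from dec obtain N where N: "N \<in> null_sets \<nu>" "emeasure \<sigma> (space \<nu> - N) = 0"
    and s: "sets \<sigma> = sets \<nu>" and [measurable]: "\<rho>' \<in> borel_measurable \<nu>" and "\<And>x. 0 \<le> \<rho>' x"
    by (auto simp: lebesgue_decomposition_def)
  have sp: "space \<sigma> = space \<nu>" using s by (rule sets_eq_imp_space_eq)
  have "absolutely_continuous \<nu> ?\<mu>" using assms by (intro absolutely_continuousI_density) auto
  then have "emeasure ?\<mu> N = 0" using N(1) by (auto simp: absolutely_continuous_def)
  then have "emeasure \<sigma> N = 0" using dec N(1) by (auto simp: lebesgue_decomposition_def)
  then have "N \<in> null_sets \<sigma>" "space \<nu> - N \<in> null_sets \<sigma>" using N s by auto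
  then have "N \<union> (space \<nu> - N) \<in> null_sets \<sigma>" by (rule null_sets.Un)
  moreover have "N \<union> (space \<nu> - N) = space \<sigma>"
    using sets.sets_into_space[of N \<nu>] N(1) sp by auto
  ultimately show 0: "emeasure \<sigma> (space \<sigma>) = 0" by auto
  have "density \<nu> (\<lambda>x. ennreal (\<rho>' x)) = ?\<mu>"
    using lebesgue_decomposition_no_singular_part[OF dec _ 0] by simp
  then have "AE x in \<nu>. ennreal (\<rho>' x) = ennreal (\<rho> x)"
    using assms by (intro \<nu>.density_unique) auto
  then show "AE x in \<nu>. \<rho>' x = \<rho> x"
    by eventually_elim (use assms(3) \<open>\<And>x. 0 \<le> \<rho>' x\<close> in auto)
qed

text \<open>Trades the \<open>SOME\<close> for a named decomposition, the same for every
  \<open>U\<close>.\<close>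

lemma U_functional_decomposition:
  assumes "finite_measure \<nu>" "finite_measure \<mu>" "sets \<mu> = sets \<nu>"
  obtains \<rho> \<sigma> where "lebesgue_decomposition \<nu> \<mu> \<rho> \<sigma>"
    and "\<And>U. U_functional \<nu> U \<mu> =
      enn2ereal (\<integral>\<^sup>+ x. ennreal (U (\<rho> x)) \<partial>\<nu>) - enn2ereal (\<integral>\<^sup>+ x. ennreal (- U (\<rho> x)) \<partial>\<nu>)
       + slope_at_infinity U * enn2ereal (emeasure \<sigma> (space \<sigma>))"
proof -
  define q where "q = (SOME q. lebesgue_decomposition \<nu> \<mu> (fst q) (snd q))"
  have "\<exists>q. lebesgue_decomposition \<nu> \<mu> (fst q) (snd q)"
    using lebesgue_decomposition_exists[OF assms] by auto
  then have "lebesgue_decomposition \<nu> \<mu> (fst q) (snd q)"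
    unfolding q_def by (rule someI_ex)
  then show ?thesis
    by (rule that) (simp add: U_functional_def q_def[symmetric] Let_def case_prod_beta)
qed

lemma U_functional_density:
  assumes "finite_measure \<nu>" "\<rho> \<in> borel_measurable \<nu>" "\<And>x. 0 \<le> \<rho> x"
    and "finite_measure (density \<nu> (\<lambda>x. ennreal (\<rho> x)))"
    and int: "integrable \<nu> (\<lambda>x. U (\<rho> x))"
  shows "U_functional \<nu> U (density \<nu> (\<lambda>x. ennreal (\<rho> x))) = ereal (\<integral>x. U (\<rho> x) \<partial>\<nu>)"
proof -
  obtain \<rho>' \<sigma> where dec: "lebesgue_decomposition \<nu> (density \<nu> (\<lambda>x. ennreal (\<rho> x))) \<rho>' \<sigma>"
    and U: "U_functional \<nu> U (density \<nu> (\<lambda>x. ennreal (\<rho> x))) =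
      enn2ereal (\<integral>\<^sup>+ x. ennreal (U (\<rho>' x)) \<partial>\<nu>) - enn2ereal (\<integral>\<^sup>+ x. ennreal (- U (\<rho>' x)) \<partial>\<nu>)
       + slope_at_infinity U * enn2ereal (emeasure \<sigma> (space \<sigma>))"
    using U_functional_decomposition[OF assms(1,4)] by (metis sets_density)
  note un = lebesgue_decomposition_density[OF assms(1-3) dec]
  have 1: "(\<integral>\<^sup>+ x. ennreal (U (\<rho>' x)) \<partial>\<nu>) = (\<integral>\<^sup>+ x. ennreal (U (\<rho> x)) \<partial>\<nu>)"
    "(\<integral>\<^sup>+ x. ennreal (- U (\<rho>' x)) \<partial>\<nu>) = (\<integral>\<^sup>+ x. ennreal (- U (\<rho> x)) \<partial>\<nu>)"
    using un(1) by (auto intro!: nn_integral_cong_AE)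
  obtain r q where rq: "0 \<le> r" "0 \<le> q" "(\<integral>\<^sup>+ x. ennreal (U (\<rho> x)) \<partial>\<nu>) = ennreal r"
      "(\<integral>\<^sup>+ x. ennreal (- U (\<rho> x)) \<partial>\<nu>) = ennreal q" "integral\<^sup>L \<nu> (\<lambda>x. U (\<rho> x)) = r - q"
    using integrableE[OF int] by metis
  \<comment> \<open>The singular term is \<open>slope_at_infinity U * 0\<close>, which is 0 in
    \<open>ereal\<close> even if the slope is infinite.\<close>
  show ?thesis unfolding U 1 using rq un(2) by (simp add: enn2ereal_ennreal zero_ennreal.rep_eq)
qed

section \<open>Couplings\<close>

text \<open>\<open>borel_prod\<close> does not apply: it needs the class of second countable spaces.\<close>

lemma sets_pair_borel_compact:
  assumes "compact (UNIV :: 'a::metric_space set)"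
  shows "sets (borel \<Otimes>\<^sub>M borel) = sets (borel :: ('a \<times> 'a) measure)"
proof
  show "sets (borel \<Otimes>\<^sub>M borel) \<subseteq> sets (borel :: ('a \<times> 'a) measure)"
    by (intro sets_pair_in_sets borel_Times)
next
  \<comment> \<open>Total boundedness supplies finite nets; products of balls around net points form
    a countable base of the product topology.\<close>
  have "\<forall>n. \<exists>F::'a set. finite F \<and> UNIV \<subseteq> (\<Union>x\<in>F. ball x (1 / Suc n))"
    using assms unfolding compact_eq_totally_bounded by auto
  then obtain F :: "nat \<Rightarrow> 'a set"
    where F: "\<And>n. finite (F n)" "\<And>n. UNIV \<subseteq> (\<Union>x\<in>F n. ball x (1 / Suc n))" by metis
  have "S \<in> sets (borel \<Otimes>\<^sub>M borel)" if "open S" for S :: "('a \<times> 'a) set"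
  proof -
    define Q where "Q n = {(a, b) \<in> F n \<times> F n. ball a (1 / Suc n) \<times> ball b (1 / Suc n) \<subseteq> S}" for n
    have "finite (Q n)" for n
      using F(1)[of n] unfolding Q_def by (intro finite_subset[OF _ finite_cartesian_product]) auto
    then have "(\<Union>n. \<Union>(a, b)\<in>Q n. ball a (1 / Suc n) \<times> ball b (1 / Suc n)) \<in> sets (borel \<Otimes>\<^sub>M borel)"
      by (intro sets.countable_UN'' sets.finite_UN) (auto simp: case_prod_beta)
    also have "(\<Union>n. \<Union>(a, b)\<in>Q n. ball a (1 / Suc n) \<times> ball b (1 / Suc n)) = S"
    proof (intro equalityI subsetI)
      fix z assume "z \<in> S"
      obtain x y where z: "z = (x, y)" by (cases z)
      obtain A B where AB: "open A" "open B" "x \<in> A" "y \<in> B" "A \<times> B \<subseteq> S"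
        using open_prod_elim[OF \<open>open S\<close> \<open>z \<in> S\<close>] unfolding z by (metis mem_Sigma_iff)
      obtain e1 where e1: "e1 > 0" "ball x e1 \<subseteq> A" using openE[OF AB(1,3)] by blast
      obtain e2 where e2: "e2 > 0" "ball y e2 \<subseteq> B" using openE[OF AB(2,4)] by blast
      note e = e1 e2
      \<comment> \<open>Half of the radius, because a ball around a net point has to fit into the
        ball around \<open>x\<close> or \<open>y\<close>, which costs the radius twice.\<close>
      obtain n where n: "1 / Suc n < min e1 e2 / 2"
        using reals_Archimedean[of "min e1 e2 / 2"] e by (auto simp: inverse_eq_divide)
      obtain a b where ab: "a \<in> F n" "x \<in> ball a (1 / Suc n)" "b \<in> F n" "y \<in> ball b (1 / Suc n)"
        using F(2)[of n] by blast
      have "ball a (1 / Suc n) \<subseteq> ball x e1" "ball b (1 / Suc n) \<subseteq> ball y e2"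
      proof -
        show "ball a (1 / Suc n) \<subseteq> ball x e1"
        proof
          fix u assume "u \<in> ball a (1 / Suc n)"
          then show "u \<in> ball x e1"
            using dist_triangle3[of x u a] ab(2) n by (simp del: of_nat_Suc)
        qed
        show "ball b (1 / Suc n) \<subseteq> ball y e2"
        proof
          fix u assume "u \<in> ball b (1 / Suc n)"
          then show "u \<in> ball y e2"
            using dist_triangle3[of y u b] ab(4) n by (simp del: of_nat_Suc)
        qed
      qed
      then have "ball a (1 / Suc n) \<times> ball b (1 / Suc n) \<subseteq> S" using AB e by blast
      then have "(a, b) \<in> Q n" using ab by (simp add: Q_def)
      then show "z \<in> (\<Union>n. \<Union>(a, b)\<in>Q n. ball a (1 / Suc n) \<times> ball b (1 / Suc n))"
        using ab z by (intro UN_I[of n] UN_I[of "(a, b)"]) auto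
    qed (auto simp: Q_def)
    finally show ?thesis .
  qed
  then have "sigma_sets UNIV {S. open S} \<subseteq> sets (borel \<Otimes>\<^sub>M borel :: ('a \<times> 'a) measure)"
    using sets.sigma_sets_subset[of "{S. open S}" "borel \<Otimes>\<^sub>M borel :: ('a \<times> 'a) measure"]
    by (auto simp: space_pair_measure)
  then show "sets borel \<subseteq> sets (borel \<Otimes>\<^sub>M borel :: ('a \<times> 'a) measure)"
    by (simp add: borel_def)
qed

text \<open>Compactness enters because \<open>couplings\<close> asks for the Borel sets of the
  product space, while the product measure lives on the product sigma-algebra.\<close>

lemma couplings_nonempty:
  fixes \<mu> :: "'a::metric_space measure"
  assumes "compact (UNIV :: 'a set)" "\<mu> \<in> P2" "\<mu>' \<in> P2"
  shows "\<mu> \<Otimes>\<^sub>M \<mu>' \<in> couplings \<mu> \<mu>'"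
proof -
  interpret M: prob_space \<mu> using assms by (simp add: P2_def)
  interpret M': prob_space \<mu>' using assms by (simp add: P2_def)
  have s: "sets \<mu> = sets borel" "sets \<mu>' = sets borel" using assms by (auto simp: P2_def)
  then have sp: "space \<mu> = UNIV" "space \<mu>' = UNIV" by (metis sets_eq_imp_space_eq space_borel)+
  have e1: "emeasure \<mu> UNIV = 1" "emeasure \<mu>' UNIV = 1"
    using M.emeasure_space_1 M'.emeasure_space_1 unfolding sp by auto
  have m: "fst \<in> measurable (\<mu> \<Otimes>\<^sub>M \<mu>') borel" "snd \<in> measurable (\<mu> \<Otimes>\<^sub>M \<mu>') borel"
    using measurable_fst[of \<mu> \<mu>'] measurable_snd[of \<mu> \<mu>'] s
    by (auto simp: measurable_cong_sets[OF refl s(1)] measurable_cong_sets[OF refl s(2)])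
  have "sets (\<mu> \<Otimes>\<^sub>M \<mu>') = sets borel"
    using sets_pair_measure_cong[OF s] sets_pair_borel_compact[OF assms(1)] by simp
  moreover have "distr (\<mu> \<Otimes>\<^sub>M \<mu>') borel fst = \<mu>"
  proof (rule measure_eqI)
    fix A assume "A \<in> sets (distr (\<mu> \<Otimes>\<^sub>M \<mu>') borel fst)"
    then have A: "A \<in> sets borel" by simp
    have "fst -` A \<inter> space (\<mu> \<Otimes>\<^sub>M \<mu>') = A \<times> space \<mu>'" by (auto simp: space_pair_measure sp)
    then show "emeasure (distr (\<mu> \<Otimes>\<^sub>M \<mu>') borel fst) A = emeasure \<mu> A"
      using A s m M'.emeasure_pair_measure_Times[of A \<mu> UNIV] by (simp add: emeasure_distr e1 sp)
  qed (simp add: s)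
  moreover have "distr (\<mu> \<Otimes>\<^sub>M \<mu>') borel snd = \<mu>'"
  proof (rule measure_eqI)
    fix A assume "A \<in> sets (distr (\<mu> \<Otimes>\<^sub>M \<mu>') borel snd)"
    then have A: "A \<in> sets borel" by simp
    have "snd -` A \<inter> space (\<mu> \<Otimes>\<^sub>M \<mu>') = space \<mu> \<times> A" by (auto simp: space_pair_measure sp)
    then show "emeasure (distr (\<mu> \<Otimes>\<^sub>M \<mu>') borel snd) A = emeasure \<mu>' A"
      using A s m M'.emeasure_pair_measure_Times[of UNIV \<mu> A] by (simp add: emeasure_distr e1 sp)
  qed (simp add: s)
  ultimately show ?thesis by (simp add: couplings_def)
qed

lemma measurable_fst_snd_borel:
  fixes \<pi> :: "('a::metric_space \<times> 'a) measure"
  assumes "sets \<pi> = sets borel"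
  shows "fst \<in> measurable \<pi> borel" "snd \<in> measurable \<pi> borel"
    "(\<lambda>z. dist (fst z) (snd z)) \<in> borel_measurable \<pi>"
  unfolding measurable_cong_sets[OF assms refl]
  by (intro borel_measurable_continuous_onI continuous_intros)+

lemma prob_space_coupling:
  assumes "\<pi> \<in> couplings \<mu> \<mu>'" "\<mu> \<in> P2"
  shows "prob_space \<pi>"
proof -
  have s: "sets \<pi> = sets borel" and d: "distr \<pi> borel fst = \<mu>"
    using assms by (auto simp: couplings_def)
  have "prob_space (distr \<pi> borel fst)" using d assms by (simp add: P2_def)
  then show ?thesis using prob_space_distrD[OF measurable_fst_snd_borel(1)[OF s]] by blast
qed

lemma dist_le_diameter:
  fixes x y :: "'a::metric_space"
  assumes "compact (UNIV :: 'a set)"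
  shows "dist x y \<le> diameter (UNIV :: 'a set)"
  by (intro diameter_bounded_bound compact_imp_bounded[OF assms]) auto

text \<open>Every coupling costs at most the squared diameter and the product measure is one, so the
  infimum \<open>w\<close> is finite. Hence \<open>enn2real\<close> is faithful, and some coupling
  costs less than \<open>w + e\<close>.\<close>

lemma
  fixes \<mu> :: "'a::metric_space measure"
  assumes comp: "compact (UNIV :: 'a set)" and P: "\<mu> \<in> P2" "\<mu>' \<in> P2"
  shows W2_le_diameter: "W2 \<mu> \<mu>' \<le> diameter (UNIV :: 'a set)"
    and near_optimal_coupling: "0 < e \<Longrightarrow>
      \<exists>\<pi>\<in>couplings \<mu> \<mu>'. (\<integral>z. (dist (fst z) (snd z))\<^sup>2 \<partial>\<pi>) \<le> (W2 \<mu> \<mu>')\<^sup>2 + e"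
proof -
  let ?D = "diameter (UNIV :: 'a set)"
  let ?c = "\<lambda>\<pi>::('a \<times> 'a) measure. \<integral>\<^sup>+ z. ennreal ((dist (fst z) (snd z))\<^sup>2) \<partial>\<pi>"
  define w where "w = (INF \<pi> \<in> couplings \<mu> \<mu>'. ?c \<pi>)"
  have D: "?D \<ge> 0" using dist_le_diameter[OF comp, of undefined undefined] by simp
  have bound: "?c \<pi> \<le> ennreal (?D\<^sup>2)" if "\<pi> \<in> couplings \<mu> \<mu>'" for \<pi>
  proof -
    interpret prob_space \<pi> using prob_space_coupling[OF that P(1)] .
    have "?c \<pi> \<le> (\<integral>\<^sup>+ z. ennreal (?D\<^sup>2) \<partial>\<pi>)"
      by (intro nn_integral_mono ennreal_leI power_mono dist_le_diameter[OF comp]) auto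
    then show ?thesis by (simp add: emeasure_space_1)
  qed
  note ne = couplings_nonempty[OF comp P]
  have w: "w \<le> ennreal (?D\<^sup>2)" unfolding w_def using ne bound[OF ne] by (rule INF_lower2)
  then have W: "W2 \<mu> \<mu>' = sqrt (enn2real w)" and wfin: "w < top"
    by (auto simp: W2_def w_def intro: le_less_trans)
  have "enn2real w \<le> ?D\<^sup>2" using enn2real_mono[OF w] by simp
  then have "sqrt (enn2real w) \<le> sqrt (?D\<^sup>2)" by (rule real_sqrt_le_mono)
  then show "W2 \<mu> \<mu>' \<le> ?D" using D by (simp add: W)
  assume e: "0 < e"
  have W2: "(W2 \<mu> \<mu>')\<^sup>2 = enn2real w" by (simp add: W)
  have "w + 0 < w + ennreal e"
    using wfin e by (intro ennreal_add_left_cancel_less[THEN iffD2]) auto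
  then have "w < w + ennreal e" by simp
  then obtain \<pi> where \<pi>: "\<pi> \<in> couplings \<mu> \<mu>'" "?c \<pi> < w + ennreal e"
    unfolding w_def INF_less_iff by auto
  have "(\<integral>z. (dist (fst z) (snd z))\<^sup>2 \<partial>\<pi>) = enn2real (?c \<pi>)"
    using \<pi>(1) measurable_fst_snd_borel(3)[of \<pi>]
    by (intro integral_eq_nn_integral borel_measurable_power) (auto simp: couplings_def)
  also have "\<dots> \<le> enn2real (w + ennreal e)"
    using \<pi>(2) wfin by (intro enn2real_mono) (auto simp: less_top[symmetric] top_unique)
  also have "\<dots> = (W2 \<mu> \<mu>')\<^sup>2 + e"
    using wfin e by (simp add: enn2real_plus W2)
  finally show "\<exists>\<pi>\<in>couplings \<mu> \<mu>'. (\<integral>z. (dist (fst z) (snd z))\<^sup>2 \<partial>\<pi>) \<le> (W2 \<mu> \<mu>')\<^sup>2 + e"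
    using \<pi>(1) by blast
qed

section \<open>Integrability and differences of integrals along a coupling\<close>

lemma P2_integrable_continuous:
  fixes g :: "'a::metric_space \<Rightarrow> real"
  assumes "compact (UNIV :: 'a set)" "\<mu> \<in> P2" "continuous_on UNIV g"
  shows "integrable \<mu> g"
proof -
  interpret prob_space \<mu> using assms by (simp add: P2_def)
  have s: "sets \<mu> = sets borel" using assms by (simp add: P2_def)
  obtain B where "\<And>x. norm (g x) \<le> B"
    using compact_imp_bounded[OF compact_continuous_image[OF assms(3,1)]] by (auto simp: bounded_iff)
  then show ?thesis
    using borel_measurable_continuous_onI[OF assms(3)] s
    by (intro integrable_const_bound[of _ B]) (auto simp: measurable_cong_sets[OF s refl])
qed

lemma P2_integrable_bounded:
  fixes g :: "'a::metric_space \<Rightarrow> real"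
  assumes "\<mu> \<in> P2" "g \<in> borel_measurable borel" "\<And>x. \<bar>g x\<bar> \<le> B"
  shows "integrable \<mu> g"
proof -
  interpret prob_space \<mu> using assms by (simp add: P2_def)
  have s: "sets \<mu> = sets borel" using assms by (simp add: P2_def)
  show ?thesis
    using assms by (intro integrable_const_bound[of _ B]) (auto simp: measurable_cong_sets[OF s refl])
qed

text \<open>For \<open>d \<ge> \<delta>\<close> the slope \<open>g\<close> gives no control of \<open>u\<close>; there the factor \<open>d\<^sup>2 / \<delta>\<^sup>2 \<ge> 1\<close> absorbs the
  Lipschitz bound.\<close>

lemma young_dist_quotient:
  fixes u d g L :: real
  assumes "0 \<le> d" "0 < a" "0 < \<delta>" "u \<le> L * d" "d < \<delta> \<Longrightarrow> u \<le> g * d"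
  shows "u \<le> a / 2 * (g\<^sup>2 + L\<^sup>2 / \<delta>\<^sup>2 * d\<^sup>2) + d\<^sup>2 / (2 * a)"
proof -
  have young: "q * d \<le> a / 2 * q\<^sup>2 + d\<^sup>2 / (2 * a)" for q
  proof -
    have "0 \<le> (a * q - d)\<^sup>2 / (2 * a)" using assms by simp
    also have "\<dots> = a / 2 * q\<^sup>2 + d\<^sup>2 / (2 * a) - q * d"
      using assms by (simp add: power2_eq_square field_simps)
    finally show ?thesis by simp
  qed
  show ?thesis
  proof (cases "d < \<delta>")
    case True
    have "u \<le> a / 2 * g\<^sup>2 + d\<^sup>2 / (2 * a)" using assms(5)[OF True] young[of g] by simp
    also have "\<dots> \<le> a / 2 * (g\<^sup>2 + L\<^sup>2 / \<delta>\<^sup>2 * d\<^sup>2) + d\<^sup>2 / (2 * a)"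
      using assms by (intro add_mono mult_left_mono) auto
    finally show ?thesis .
  next
    case False
    then have "\<delta>\<^sup>2 \<le> d\<^sup>2" using assms by (intro power_mono) auto
    then have "1 \<le> d\<^sup>2 / \<delta>\<^sup>2" using assms by simp
    then have "L\<^sup>2 * 1 \<le> L\<^sup>2 * (d\<^sup>2 / \<delta>\<^sup>2)" by (intro mult_left_mono) auto
    then have "L\<^sup>2 \<le> g\<^sup>2 + L\<^sup>2 / \<delta>\<^sup>2 * d\<^sup>2" by (simp add: add_increasing)
    then have "a / 2 * L\<^sup>2 \<le> a / 2 * (g\<^sup>2 + L\<^sup>2 / \<delta>\<^sup>2 * d\<^sup>2)"
      using assms by (intro mult_left_mono) auto
    then show ?thesis using young[of L] assms(4) by linarith
  qed
qed

text \<open>Integrates \<open>young_dist_quotient\<close> over the coupling with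
  \<open>u = \<phi> (fst z) - \<phi> (snd z)\<close>. The slope is taken at the first point, so its
  integral involves only the marginal \<open>\<mu>\<close>.\<close>

lemma coupling_integral_diff_le:
  fixes \<phi> :: "'a::metric_space \<Rightarrow> real"
  assumes comp: "compact (UNIV :: 'a set)" and P: "\<mu> \<in> P2" "\<mu>' \<in> P2"
    and \<pi>: "\<pi> \<in> couplings \<mu> \<mu>'" and L: "L-lipschitz_on UNIV \<phi>" and "0 < a" "0 < \<delta>"
  defines "E \<equiv> \<integral>z. (dist (fst z) (snd z))\<^sup>2 \<partial>\<pi>"
  shows "(\<integral>x. \<phi> x \<partial>\<mu>) - (\<integral>x. \<phi> x \<partial>\<mu>')
    \<le> a / 2 * ((\<integral>x. (local_slope \<delta> \<phi> x)\<^sup>2 \<partial>\<mu>) + L\<^sup>2 / \<delta>\<^sup>2 * E) + E / (2 * a)"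
proof -
  interpret prob_space \<pi> using prob_space_coupling[OF \<pi> P(1)] .
  have s: "sets \<pi> = sets borel" and d: "distr \<pi> borel fst = \<mu>" "distr \<pi> borel snd = \<mu>'"
    using \<pi> by (auto simp: couplings_def)
  note m = measurable_fst_snd_borel[OF s]
  have cont: "continuous_on UNIV \<phi>" using L by (rule lipschitz_on_continuous_on)
  have b\<phi>: "\<phi> \<in> borel_measurable borel" by (rule borel_measurable_continuous_onI[OF cont])
  define G where "G x = (local_slope \<delta> \<phi> x)\<^sup>2" for x
  have bG: "G \<in> borel_measurable borel"
    unfolding G_def using borel_measurable_local_slope[OF L \<open>0 < \<delta>\<close>] by (rule borel_measurable_power)
  have "\<bar>G x\<bar> \<le> L\<^sup>2" for x
    unfolding G_def using local_slope_nonneg[OF L \<open>0 < \<delta>\<close>, of x] local_slope_le_lipschitz[OF L \<open>0 < \<delta>\<close>, of x]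
    by (simp add: power_mono)
  then have "integrable (distr \<pi> borel fst) G"
    unfolding d by (intro P2_integrable_bounded[OF P(1) bG])
  then have iG: "integrable \<pi> (\<lambda>z. G (fst z))" using integrable_distr_eq[OF m(1) bG] by simp
  have eG: "(\<integral>x. G x \<partial>\<mu>) = (\<integral>z. G (fst z) \<partial>\<pi>)"
    using integral_distr[OF m(1) bG] by (simp add: d)
  have i1: "integrable \<pi> (\<lambda>z. \<phi> (fst z))"
    using P2_integrable_continuous[OF comp P(1) cont] integrable_distr_eq[OF m(1) b\<phi>] by (simp add: d)
  have i2: "integrable \<pi> (\<lambda>z. \<phi> (snd z))"
    using P2_integrable_continuous[OF comp P(2) cont] integrable_distr_eq[OF m(2) b\<phi>] by (simp add: d)
  have iE: "integrable \<pi> (\<lambda>z. (dist (fst z) (snd z))\<^sup>2)"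
    using dist_le_diameter[OF comp] m(3)
    by (intro integrable_const_bound[of _ "(diameter (UNIV :: 'a set))\<^sup>2"])
      (auto intro!: AE_I2 power_mono)
  have "(\<integral>x. \<phi> x \<partial>\<mu>) - (\<integral>x. \<phi> x \<partial>\<mu>') = (\<integral>z. \<phi> (fst z) - \<phi> (snd z) \<partial>\<pi>)"
    using integral_distr[OF m(1) b\<phi>] integral_distr[OF m(2) b\<phi>] i1 i2 by (simp add: d)
  also have "\<dots> \<le> (\<integral>z. a / 2 * (G (fst z) + L\<^sup>2 / \<delta>\<^sup>2 * (dist (fst z) (snd z))\<^sup>2)
      + (dist (fst z) (snd z))\<^sup>2 / (2 * a) \<partial>\<pi>)"
  proof (rule integral_mono)
    fix z
    show "\<phi> (fst z) - \<phi> (snd z) \<le> a / 2 * (G (fst z) + L\<^sup>2 / \<delta>\<^sup>2 * (dist (fst z) (snd z))\<^sup>2)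
      + (dist (fst z) (snd z))\<^sup>2 / (2 * a)"
      unfolding G_def
    proof (rule young_dist_quotient)
      show "\<phi> (fst z) - \<phi> (snd z) \<le> L * dist (fst z) (snd z)"
        using lipschitz_onD[OF L, of "fst z" "snd z"] by (simp add: dist_real_def)
      assume "dist (fst z) (snd z) < \<delta>"
      then have "\<bar>\<phi> (snd z) - \<phi> (fst z)\<bar> / dist (fst z) (snd z) \<le> local_slope \<delta> \<phi> (fst z)"
        by (rule quotient_le_local_slope[OF L])
      then show "\<phi> (fst z) - \<phi> (snd z) \<le> local_slope \<delta> \<phi> (fst z) * dist (fst z) (snd z)"
        by (cases "fst z = snd z") (auto simp: divide_le_eq)
    qed (use \<open>0 < a\<close> \<open>0 < \<delta>\<close> in auto)
  qed (use i1 i2 iG iE in auto)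
  also have "\<dots> = a / 2 * ((\<integral>z. G (fst z) \<partial>\<pi>) + L\<^sup>2 / \<delta>\<^sup>2 * E) + E / (2 * a)"
    unfolding E_def using iG iE by simp
  finally show ?thesis unfolding G_def[symmetric] eG .
qed

section \<open>The entropy inequality\<close>

text \<open>The Gibbs variational inequality for the density \<open>exp \<phi>\<close>. The entropy
  enters through a real upper bound \<open>c\<close>, which excludes a singular part of
  \<open>\<mu>\<close> and makes the entropy an ordinary integral.\<close>

lemma integral_le_relative_entropy:
  fixes \<phi> :: "'a::metric_space \<Rightarrow> real"
  assumes comp: "compact (UNIV :: 'a set)" and \<nu>: "\<nu> \<in> P2" and \<mu>: "\<mu> \<in> P2"
    and cont: "continuous_on UNIV \<phi>" and "(\<integral>x. exp (\<phi> x) \<partial>\<nu>) = 1"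
    and le: "U_functional \<nu> ent \<mu> \<le> ereal c"
  shows "(\<integral>x. \<phi> x \<partial>\<mu>) \<le> c"
proof -
  interpret N: prob_space \<nu> using \<nu> by (simp add: P2_def)
  interpret M: prob_space \<mu> using \<mu> by (simp add: P2_def)
  have s: "sets \<nu> = sets borel" "sets \<mu> = sets \<nu>" using \<nu> \<mu> by (auto simp: P2_def)
  obtain \<rho> \<sigma> where dec: "lebesgue_decomposition \<nu> \<mu> \<rho> \<sigma>"
    and U: "\<And>U. U_functional \<nu> U \<mu> =
      enn2ereal (\<integral>\<^sup>+ x. ennreal (U (\<rho> x)) \<partial>\<nu>) - enn2ereal (\<integral>\<^sup>+ x. ennreal (- U (\<rho> x)) \<partial>\<nu>)
       + slope_at_infinity U * enn2ereal (emeasure \<sigma> (space \<sigma>))"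
    using U_functional_decomposition[OF N.finite_measure_axioms M.finite_measure_axioms s(2)] by metis
  from dec have \<rho>[measurable]: "\<rho> \<in> borel_measurable \<nu>" and \<rho>0: "\<And>x. 0 \<le> \<rho> x"
    by (auto simp: lebesgue_decomposition_def)
  have [measurable]: "\<phi> \<in> borel_measurable \<nu>"
    using borel_measurable_continuous_onI[OF cont] by (simp add: measurable_cong_sets[OF s(1) refl])
  define A where "A = (\<integral>\<^sup>+ x. ennreal (ent (\<rho> x)) \<partial>\<nu>)"
  define B where "B = (\<integral>\<^sup>+ x. ennreal (- ent (\<rho> x)) \<partial>\<nu>)"
  \<comment> \<open>The negative part of the entropy density is at most 1, so its integral is finite
    and no difference of infinities arises.\<close>
  have "B \<le> (\<integral>\<^sup>+ x. ennreal 1 \<partial>\<nu>)"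
    unfolding B_def
  proof (intro nn_integral_mono ennreal_leI)
    fix x show "- ent (\<rho> x) \<le> 1" using ent_ge_minus_one[OF \<rho>0[of x]] \<rho>0[of x] by simp
  qed
  then have "B < top" by (simp add: N.emeasure_space_1 le_less_trans)
  then obtain b where b: "0 \<le> b" "B = ennreal b" by (cases B) auto
  have fin: "enn2ereal A - ereal b + \<infinity> * enn2ereal (emeasure \<sigma> (space \<sigma>)) \<le> ereal c"
    using le b unfolding U A_def[symmetric] B_def[symmetric]
    by (simp add: slope_at_infinity_ent enn2ereal_ennreal)
  have \<sigma>0: "emeasure \<sigma> (space \<sigma>) = 0"
  proof (rule ccontr)
    assume "emeasure \<sigma> (space \<sigma>) \<noteq> 0"
    then have "0 < enn2ereal (emeasure \<sigma> (space \<sigma>))"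
      by (simp add: less_ennreal.rep_eq[symmetric] zero_ennreal.rep_eq[symmetric] zero_less_iff_neq_zero)
    then have "\<infinity> * enn2ereal (emeasure \<sigma> (space \<sigma>)) = \<infinity>" by simp
    moreover have "enn2ereal A - ereal b \<noteq> - \<infinity>"
      using enn2ereal_nonneg[of A] by (cases "enn2ereal A") auto
    ultimately show False using fin by simp
  qed
  then have fin': "enn2ereal A - ereal b \<le> ereal c" using fin by (simp add: zero_ennreal.rep_eq)
  then have "A \<noteq> top" by auto
  then obtain a where a: "0 \<le> a" "A = ennreal a" by (cases A) auto
  have ient: "integrable \<nu> (\<lambda>x. ent (\<rho> x))"
    unfolding real_integrable_def A_def[symmetric] B_def[symmetric] by (simp add: a b) (simp add: ent_def)
  have "(\<integral>x. ent (\<rho> x) \<partial>\<nu>) = a - b"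
    using real_lebesgue_integral_def[OF ient] a b by (simp add: A_def[symmetric] B_def[symmetric])
  also have "\<dots> \<le> c" using fin' a by (simp add: enn2ereal_ennreal)
  finally have ent_le: "(\<integral>x. ent (\<rho> x) \<partial>\<nu>) \<le> c" .
  note d = lebesgue_decomposition_no_singular_part[OF dec s(2) \<sigma>0]
  have "integrable \<mu> (\<lambda>x. 1 + \<phi> x)"
    by (intro P2_integrable_continuous[OF comp \<mu>] continuous_intros cont)
  then have i1: "integrable \<nu> (\<lambda>x. \<rho> x * (1 + \<phi> x))"
    unfolding d using \<rho>0 by (subst (asm) integrable_density) auto
  have i2: "integrable \<nu> (\<lambda>x. exp (\<phi> x))"
    by (intro P2_integrable_continuous[OF comp \<nu>] continuous_intros cont)
  \<comment> \<open>The supporting line of \<open>ent\<close> at \<open>exp (\<phi> x)\<close>,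
    evaluated at \<open>\<rho> x\<close>, simplifies to
    \<open>\<rho> x * (1 + \<phi> x) - exp (\<phi> x)\<close>. Both measures have mass 1, so the two
    constants cancel after integration.\<close>
  have "1 + (\<integral>x. \<phi> x \<partial>\<mu>) = (\<integral>x. 1 + \<phi> x \<partial>\<mu>)"
    using P2_integrable_continuous[OF comp \<mu> cont] by (simp add: M.prob_space)
  also have "\<dots> = (\<integral>x. \<rho> x * (1 + \<phi> x) \<partial>\<nu>)"
    unfolding d using \<rho>0 by (subst integral_density) auto
  also have "\<dots> = (\<integral>x. \<rho> x * (1 + \<phi> x) - exp (\<phi> x) \<partial>\<nu>) + 1"
    using i1 i2 assms(5) by simp
  also have "(\<integral>x. \<rho> x * (1 + \<phi> x) - exp (\<phi> x) \<partial>\<nu>) \<le> (\<integral>x. ent (\<rho> x) \<partial>\<nu>)"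
  proof (rule integral_mono)
    fix x
    show "\<rho> x * (1 + \<phi> x) - exp (\<phi> x) \<le> ent (\<rho> x)"
      using ent_supporting_line[OF exp_gt_zero \<rho>0[of x], of "\<phi> x"] by (simp add: ent_def algebra_simps)
  qed (use i1 i2 ient in auto)
  finally show ?thesis using ent_le by simp
qed

lemma P2_density:
  assumes \<nu>: "\<nu> \<in> P2" and \<rho>: "\<rho> \<in> borel_measurable \<nu>" "\<And>x. 0 \<le> \<rho> x" "integrable \<nu> \<rho>"
    and "(\<integral>x. \<rho> x \<partial>\<nu>) = 1"
  shows "density \<nu> (\<lambda>x. ennreal (\<rho> x)) \<in> P2"
proof -
  have "emeasure (density \<nu> (\<lambda>x. ennreal (\<rho> x))) (space \<nu>) = (\<integral>\<^sup>+ x. ennreal (\<rho> x) \<partial>\<nu>)"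
    using \<rho> by (subst emeasure_density) (auto intro!: nn_integral_cong)
  also have "\<dots> = 1" using assms by (simp add: nn_integral_eq_integral)
  finally show ?thesis using \<nu> by (auto simp: P2_def intro: prob_spaceI)
qed

lemma msupport_density_subset:
  assumes "sets \<nu> = sets borel" "\<rho> \<in> borel_measurable \<nu>"
  shows "msupport (density \<nu> \<rho>) \<subseteq> msupport \<nu>"
proof -
  have "emeasure \<nu> S \<noteq> 0" if "open S" "emeasure (density \<nu> \<rho>) S \<noteq> 0" for S
  proof
    assume "emeasure \<nu> S = 0"
    then have "S \<in> null_sets \<nu>" using that assms by auto
    then have "S \<in> null_sets (density \<nu> \<rho>)"
      using absolutely_continuousI_density[OF assms(2)] by (auto simp: absolutely_continuous_def)
    then show False using that by auto
  qed
  then show ?thesis by (auto simp: msupport_def zero_less_iff_neq_zero)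
qed

text \<open>The number \<open>B\<close> bounds the transport term for every possible value of the
  Wasserstein distance. This keeps the argument independent of the sign of \<open>K\<close>.\<close>

lemma relative_entropy_le_grad:
  fixes \<nu> :: "'a::metric_space measure" and \<phi> :: "'a \<Rightarrow> real"
  assumes cm: "compact_measured_length_space \<nu>" and Ricci: "infinity_Ricci_bounded_below \<nu> K"
    and L: "L-lipschitz_on UNIV \<phi>" and one: "(\<integral>x. exp (\<phi> x) \<partial>\<nu>) = 1" and a: "0 < a"
    and B: "\<And>W. 0 \<le> W \<Longrightarrow> W \<le> diameter (UNIV :: 'a set) \<Longrightarrow> W\<^sup>2 * (1 / a - K) / 2 \<le> B"
  shows "(\<integral>x. exp (\<phi> x) * \<phi> x \<partial>\<nu>) \<le> a / 2 * (\<integral>x. exp (\<phi> x) * (grad_norm \<phi> x)\<^sup>2 \<partial>\<nu>) + B"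
proof -
  have comp: "compact (UNIV :: 'a set)" and \<nu>: "\<nu> \<in> P2"
    using cm by (auto simp: compact_measured_length_space_def)
  interpret N: prob_space \<nu> using \<nu> by (simp add: P2_def)
  have s: "sets \<nu> = sets borel" using \<nu> by (auto simp: P2_def)
  note ms = measurable_cong_sets[OF s refl]
  have cont: "continuous_on UNIV \<phi>" using L by (rule lipschitz_on_continuous_on)
  have m\<phi>[measurable]: "\<phi> \<in> borel_measurable \<nu>"
    unfolding ms by (rule borel_measurable_continuous_onI[OF cont])
  define \<mu> where "\<mu> = density \<nu> (\<lambda>x. ennreal (exp (\<phi> x)))"
  have int_exp: "integrable \<nu> (\<lambda>x. exp (\<phi> x))"
    by (intro P2_integrable_continuous[OF comp \<nu>] continuous_intros cont)
  have \<mu>: "\<mu> \<in> P2" unfolding \<mu>_def using one int_exp by (intro P2_density[OF \<nu>]) auto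
  interpret M: prob_space \<mu> using \<mu> by (simp add: P2_def)
  define H where "H = (\<integral>x. exp (\<phi> x) * \<phi> x \<partial>\<nu>)"
  have int_\<mu>: "(\<integral>x. g x \<partial>\<mu>) = (\<integral>x. exp (\<phi> x) * g x \<partial>\<nu>)" if "g \<in> borel_measurable borel" for g :: "'a \<Rightarrow> real"
    unfolding \<mu>_def using that m\<phi> by (subst integral_density) (auto simp: ms)
  have int_\<mu>_\<phi>: "(\<integral>x. \<phi> x \<partial>\<mu>) = H"
    unfolding H_def by (rule int_\<mu>[OF borel_measurable_continuous_onI[OF cont]])
  have U\<mu>: "U_functional \<nu> ent \<mu> = ereal H"
  proof -
    have "integrable \<nu> (\<lambda>x. exp (\<phi> x) * \<phi> x)"
      by (intro P2_integrable_continuous[OF comp \<nu>] continuous_intros cont)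
    then show ?thesis
      using U_functional_density[of \<nu> "\<lambda>x. exp (\<phi> x)" ent] N.finite_measure_axioms M.finite_measure_axioms
      by (simp add: \<mu>_def H_def ent_def)
  qed
  \<comment> \<open>The geodesic ends at \<open>\<nu>\<close>, whose density 1 has entropy 0, so
    only the entropy of \<open>\<mu>\<close> remains on the right of the convexity
    inequality.\<close>
  have U\<nu>: "U_functional \<nu> ent \<nu> = 0"
  proof -
    have "density \<nu> (\<lambda>x. ennreal 1) = \<nu>" by (simp add: density_1)
    then show ?thesis
      using U_functional_density[of \<nu> "\<lambda>_. 1" ent] N.finite_measure_axioms
      by (simp add: ent_def)
  qed
  have "msupport \<mu> \<subseteq> msupport \<nu>" unfolding \<mu>_def by (intro msupport_density_subset s) measurable
  with Ricci \<mu> \<nu> obtain m where geo: "wasserstein_geodesic \<mu> \<nu> m"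
    and conv: "\<And>U t. U \<in> DC_infinity \<Longrightarrow> t \<in> {0..1} \<Longrightarrow> U_functional \<nu> U (m t) \<le>
            ereal t * U_functional \<nu> U \<nu> + ereal (1 - t) * U_functional \<nu> U \<mu>
            - lambda_K K U * ereal (1/2 * t * (1 - t) * (W2 \<mu> \<nu>)\<^sup>2)"
    unfolding infinity_Ricci_bounded_below_def by blast
  define W where "W = W2 \<mu> \<nu>"
  have W: "0 \<le> W" "W \<le> diameter (UNIV :: 'a set)"
    using W2_le_diameter[OF comp \<mu> \<nu>] by (auto simp: W_def W2_def)
  \<comment> \<open>This is the convexity inequality at time \<open>t\<close>, already divided by
    \<open>t\<close>; the factor \<open>t\<^sup>2 * (W\<^sup>2 + t)\<close> bounds the cost of the
    coupling.\<close>
  have step: "H \<le> a / 2 * ((\<integral>x. (local_slope \<delta> \<phi> x)\<^sup>2 \<partial>\<mu>) + L\<^sup>2 / \<delta>\<^sup>2 * (t\<^sup>2 * (W\<^sup>2 + t)))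
      + (W\<^sup>2 + t) / (2 * a) - K / 2 * (1 - t) * W\<^sup>2"
    if t: "0 < t" "t < 1" and \<delta>: "0 < \<delta>" for t \<delta>
  proof -
    have t01: "t \<in> {0..1}" "0 \<in> {0..1::real}" using t by auto
    have mt: "m t \<in> P2" and m0: "m 0 = \<mu>"
      using geo t01(1) by (simp_all add: wasserstein_geodesic_def)
    have "W2 (m 0) (m t) = \<bar>0 - t\<bar> * W"
      using geo t01 unfolding wasserstein_geodesic_def W_def by blast
    then have Wt: "W2 \<mu> (m t) = t * W" using t by (simp add: m0)
    have "U_functional \<nu> ent (m t) \<le> ereal ((1 - t) * H - K * (1/2 * t * (1 - t) * W\<^sup>2))"
      using conv[OF ent_in_DC_infinity, of t] t by (simp add: U\<mu> U\<nu> lambda_K_ent W_def)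
    then have ent_t: "(\<integral>x. \<phi> x \<partial>m t) \<le> (1 - t) * H - K * (1/2 * t * (1 - t) * W\<^sup>2)"
      by (rule integral_le_relative_entropy[OF comp \<nu> mt cont one])
    \<comment> \<open>The tolerance must be of smaller order than the cost
      \<open>t\<^sup>2 * W\<^sup>2\<close>; with \<open>t ^ 3\<close> it leaves only a term of order
      \<open>t\<close> after the divisions.\<close>
    have "0 < t ^ 3" using t by simp
    from near_optimal_coupling[OF comp \<mu> mt this] obtain \<pi> where \<pi>: "\<pi> \<in> couplings \<mu> (m t)"
      and "(\<integral>z. (dist (fst z) (snd z))\<^sup>2 \<partial>\<pi>) \<le> (W2 \<mu> (m t))\<^sup>2 + t ^ 3" by blast
    moreover define E where "E = (\<integral>z. (dist (fst z) (snd z))\<^sup>2 \<partial>\<pi>)"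
    ultimately have E: "E \<le> t\<^sup>2 * (W\<^sup>2 + t)"
      by (simp add: Wt power2_eq_square power3_eq_cube algebra_simps)
    let ?G = "\<integral>x. (local_slope \<delta> \<phi> x)\<^sup>2 \<partial>\<mu>"
    \<comment> \<open>The Young parameter scales with \<open>t\<close>: both the gradient term and
      the cost divided by \<open>2 * (a * t)\<close> become of order \<open>t\<close>, so dividing
      by \<open>t\<close> leaves finite limits.\<close>
    have at: "0 < a * t" using a t by simp
    have "t * H = H - (1 - t) * H" by (simp add: algebra_simps)
    also have "\<dots> \<le> H - (\<integral>x. \<phi> x \<partial>m t) - K * (1/2 * t * (1 - t) * W\<^sup>2)"
      using ent_t by simp
    also have "H - (\<integral>x. \<phi> x \<partial>m t) \<le> a * t / 2 * (?G + L\<^sup>2 / \<delta>\<^sup>2 * E) + E / (2 * (a * t))"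
      using coupling_integral_diff_le[OF comp \<mu> mt \<pi> L at \<delta>] by (simp add: int_\<mu>_\<phi> E_def)
    also have "\<dots> \<le> a * t / 2 * (?G + L\<^sup>2 / \<delta>\<^sup>2 * (t\<^sup>2 * (W\<^sup>2 + t))) + t\<^sup>2 * (W\<^sup>2 + t) / (2 * (a * t))"
      using E at by (intro add_mono mult_left_mono divide_right_mono) auto
    also have "t\<^sup>2 * (W\<^sup>2 + t) / (2 * (a * t)) = t * ((W\<^sup>2 + t) / (2 * a))"
      using a t by (simp add: power2_eq_square field_simps)
    finally have "t * H \<le> t * (a / 2 * (?G + L\<^sup>2 / \<delta>\<^sup>2 * (t\<^sup>2 * (W\<^sup>2 + t)))
      + (W\<^sup>2 + t) / (2 * a) - K / 2 * (1 - t) * W\<^sup>2)"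
      by (simp add: algebra_simps)
    then show ?thesis using t by simp
  qed
  \<comment> \<open>Let \<open>t\<close> tend to 0 with \<open>\<delta>\<close> fixed: the factor
    \<open>t\<^sup>2\<close> removes the term with \<open>L\<^sup>2 / \<delta>\<^sup>2\<close>. Only
    afterwards may \<open>\<delta>\<close> shrink.\<close>
  have slope: "H \<le> a / 2 * (\<integral>x. (local_slope \<delta> \<phi> x)\<^sup>2 \<partial>\<mu>) + B" if \<delta>: "0 < \<delta>" for \<delta>
  proof -
    let ?G = "\<integral>x. (local_slope \<delta> \<phi> x)\<^sup>2 \<partial>\<mu>"
    have "H \<le> a / 2 * (?G + L\<^sup>2 / \<delta>\<^sup>2 * (0\<^sup>2 * (W\<^sup>2 + 0))) + (W\<^sup>2 + 0) / (2 * a) - K / 2 * (1 - 0) * W\<^sup>2"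
    proof (rule tendsto_lowerbound[OF _ _ trivial_limit_at_right_real])
      show "((\<lambda>t. a / 2 * (?G + L\<^sup>2 / \<delta>\<^sup>2 * (t\<^sup>2 * (W\<^sup>2 + t))) + (W\<^sup>2 + t) / (2 * a) - K / 2 * (1 - t) * W\<^sup>2)
        \<longlongrightarrow> a / 2 * (?G + L\<^sup>2 / \<delta>\<^sup>2 * (0\<^sup>2 * (W\<^sup>2 + 0))) + (W\<^sup>2 + 0) / (2 * a) - K / 2 * (1 - 0) * W\<^sup>2) (at_right 0)"
        using a by (intro tendsto_intros) auto
      have "\<forall>\<^sub>F t in at_right (0::real). t \<in> {0<..<1}"
        by (rule eventually_at_right_real) simp
      then show "\<forall>\<^sub>F t in at_right 0. H \<le> a / 2 * (?G + L\<^sup>2 / \<delta>\<^sup>2 * (t\<^sup>2 * (W\<^sup>2 + t)))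
          + (W\<^sup>2 + t) / (2 * a) - K / 2 * (1 - t) * W\<^sup>2"
        by eventually_elim (simp only: greaterThanLessThan_iff step[OF _ _ \<delta>])
    qed
    also have "\<dots> = a / 2 * ?G + W\<^sup>2 * (1 / a - K) / 2" using a by (simp add: field_simps)
    finally show ?thesis using B[OF W] by linarith
  qed
  have s\<mu>: "sets \<mu> = sets borel" using \<mu> by (simp add: P2_def)
  \<comment> \<open>Now the radius tends to 0, with the squared Lipschitz constant as dominating
    function.\<close>
  have "(\<lambda>n. \<integral>x. (local_slope (1 / Suc n) \<phi> x)\<^sup>2 \<partial>\<mu>) \<longlonglongrightarrow> (\<integral>x. (grad_norm \<phi> x)\<^sup>2 \<partial>\<mu>)"
  proof (rule integral_dominated_convergence[where w = "\<lambda>_. L\<^sup>2"])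
    show "(\<lambda>x. (grad_norm \<phi> x)\<^sup>2) \<in> borel_measurable \<mu>"
      unfolding measurable_cong_sets[OF s\<mu> refl]
      by (intro borel_measurable_power borel_measurable_grad_norm[OF L])
    show "(\<lambda>x. (local_slope (1 / Suc n) \<phi> x)\<^sup>2) \<in> borel_measurable \<mu>" for n
      unfolding measurable_cong_sets[OF s\<mu> refl]
      by (intro borel_measurable_power borel_measurable_local_slope[OF L]) simp
    show "AE x in \<mu>. (\<lambda>n. (local_slope (1 / Suc n) \<phi> x)\<^sup>2) \<longlonglongrightarrow> (grad_norm \<phi> x)\<^sup>2"
      by (intro AE_I2 tendsto_power tendsto_local_slope_seq[OF L])
    show "AE x in \<mu>. norm ((local_slope (1 / Suc n) \<phi> x)\<^sup>2) \<le> L\<^sup>2" for n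
      using local_slope_nonneg[OF L, of "1 / Suc n"] local_slope_le_lipschitz[OF L, of "1 / Suc n"]
      by (intro AE_I2) (simp add: power_mono)
  qed simp
  then have "(\<lambda>n. a / 2 * (\<integral>x. (local_slope (1 / Suc n) \<phi> x)\<^sup>2 \<partial>\<mu>) + B)
      \<longlonglongrightarrow> a / 2 * (\<integral>x. (grad_norm \<phi> x)\<^sup>2 \<partial>\<mu>) + B"
    by (intro tendsto_intros)
  then have "H \<le> a / 2 * (\<integral>x. (grad_norm \<phi> x)\<^sup>2 \<partial>\<mu>) + B"
    by (rule LIMSEQ_le_const) (intro exI[of _ 0] allI impI slope, simp)
  also have "(\<integral>x. (grad_norm \<phi> x)\<^sup>2 \<partial>\<mu>) = (\<integral>x. exp (\<phi> x) * (grad_norm \<phi> x)\<^sup>2 \<partial>\<nu>)"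
    by (rule int_\<mu>[OF borel_measurable_power[OF borel_measurable_grad_norm[OF L]]])
  finally show ?thesis unfolding H_def .
qed

section \<open>Elementary estimates for the logarithm of a shifted square\<close>

lemma abs_ln_diff_le:
  fixes x y :: real
  assumes "0 < x" "0 < y"
  shows "\<bar>ln y - ln x\<bar> \<le> \<bar>y - x\<bar> / min x y"
proof -
  have le: "ln v - ln u \<le> (v - u) / u" if "0 < u" "u \<le> v" for u v :: real
    using ln_le_minus_one[of "v / u"] that by (simp add: ln_div field_simps)
  show ?thesis
  proof (cases "x \<le> y")
    case True
    then show ?thesis using le[of x y] assms by (simp add: min_def)
  next
    case False
    then show ?thesis using le[of y x] assms by (simp add: min_def)
  qed
qed

text \<open>With \<open>p\<close> and \<open>q\<close> the two roots,
  \<open>q\<^sup>2 - p\<^sup>2 = v\<^sup>2 - u\<^sup>2\<close>; factor both sides and use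
  \<open>\<bar>v + u\<bar> \<le> q + p\<close>.\<close>

lemma sqrt_shift_diff_le:
  fixes u v \<epsilon> :: real
  assumes "0 < \<epsilon>"
  shows "\<bar>sqrt (v\<^sup>2 + \<epsilon>) - sqrt (u\<^sup>2 + \<epsilon>)\<bar> \<le> \<bar>v - u\<bar>"
proof -
  define p q where "p = sqrt (u\<^sup>2 + \<epsilon>)" and "q = sqrt (v\<^sup>2 + \<epsilon>)"
  have pos: "0 < p" "0 < q" using assms by (auto simp: p_def q_def add_nonneg_pos)
  have sq: "p\<^sup>2 = u\<^sup>2 + \<epsilon>" "q\<^sup>2 = v\<^sup>2 + \<epsilon>" using assms by (auto simp: p_def q_def)
  have "\<bar>u\<bar> \<le> p" "\<bar>v\<bar> \<le> q"
    using assms by (auto simp: p_def q_def intro!: real_le_rsqrt)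
  then have uv: "\<bar>v + u\<bar> \<le> q + p" by linarith
  have "(q - p) * (q + p) = (v - u) * (v + u)"
    using sq by (simp add: power2_eq_square algebra_simps)
  then have "\<bar>q - p\<bar> * (q + p) = \<bar>v - u\<bar> * \<bar>v + u\<bar>"
    using pos by (metis abs_mult abs_of_pos add_pos_pos)
  also have "\<dots> \<le> \<bar>v - u\<bar> * (q + p)" using uv by (intro mult_left_mono) auto
  finally have "\<bar>q - p\<bar> \<le> \<bar>v - u\<bar>" using pos by simp
  then show ?thesis by (simp add: p_def q_def)
qed

text \<open>Both bounds come from \<open>ln (u\<^sup>2 + \<epsilon>) = 2 * ln p\<close> with
  \<open>p = sqrt (u\<^sup>2 + \<epsilon>)\<close>. The first makes the log-density Lipschitz; the
  second has the shape required by \<open>grad_norm_chain\<close>, with leading factor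
  \<open>2 / p\<close>.\<close>

lemma ln_shift_diff_le:
  fixes u v \<epsilon> :: real
  assumes "0 < \<epsilon>"
  shows "\<bar>ln (v\<^sup>2 + \<epsilon>) - ln (u\<^sup>2 + \<epsilon>)\<bar> \<le> 2 / sqrt \<epsilon> * \<bar>v - u\<bar>"
    and "\<bar>ln (v\<^sup>2 + \<epsilon>) - ln (u\<^sup>2 + \<epsilon>)\<bar> \<le> (2 / sqrt (u\<^sup>2 + \<epsilon>) + 2 / \<epsilon> * \<bar>v - u\<bar>) * \<bar>v - u\<bar>"
proof -
  define p q r where "p = sqrt (u\<^sup>2 + \<epsilon>)" and "q = sqrt (v\<^sup>2 + \<epsilon>)" and "r = sqrt \<epsilon>"
  have pos: "0 < p" "0 < q" "0 < r" using assms by (auto simp: p_def q_def r_def add_nonneg_pos)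
  have r: "r \<le> p" "r \<le> q" using assms by (auto simp: p_def q_def r_def)
  have rr: "r * r = \<epsilon>" using assms by (simp add: r_def)
  have pq: "\<bar>q - p\<bar> \<le> \<bar>v - u\<bar>" unfolding p_def q_def by (rule sqrt_shift_diff_le[OF assms])
  have "u\<^sup>2 + \<epsilon> > 0" "v\<^sup>2 + \<epsilon> > 0" using assms by (auto simp: add_nonneg_pos)
  then have "ln (u\<^sup>2 + \<epsilon>) = 2 * ln p" "ln (v\<^sup>2 + \<epsilon>) = 2 * ln q"
    by (simp_all add: p_def q_def ln_sqrt)
  then have eq: "\<bar>ln (v\<^sup>2 + \<epsilon>) - ln (u\<^sup>2 + \<epsilon>)\<bar> = 2 * \<bar>ln q - ln p\<bar>"
    by (simp add: abs_if)
  have le: "\<bar>ln q - ln p\<bar> \<le> \<bar>q - p\<bar> * (1 / min p q)" using abs_ln_diff_le[OF pos(1,2)] by simp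
  have "\<bar>q - p\<bar> * (1 / min p q) \<le> \<bar>v - u\<bar> * (1 / r)"
    using pos r pq by (intro mult_mono divide_left_mono) auto
  then show "\<bar>ln (v\<^sup>2 + \<epsilon>) - ln (u\<^sup>2 + \<epsilon>)\<bar> \<le> 2 / sqrt \<epsilon> * \<bar>v - u\<bar>"
    using le eq by (simp add: r_def mult.commute)
  \<comment> \<open>If \<open>q < p\<close>, then \<open>1 / q = 1 / p + (p - q) / (p * q)\<close>,
    and \<open>p * q \<ge> \<epsilon>\<close> since both roots are at least
    \<open>sqrt \<epsilon>\<close>.\<close>
  have "1 / min p q \<le> 1 / p + \<bar>v - u\<bar> / \<epsilon>"
  proof (cases "p \<le> q")
    case True
    then show ?thesis using assms by (simp add: min_def)
  next
    case False
    then have "1 / min p q = 1 / p + \<bar>q - p\<bar> / (p * q)"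
      using pos by (simp add: min_def field_simps)
    also have "\<bar>q - p\<bar> / (p * q) \<le> \<bar>v - u\<bar> / \<epsilon>"
      using pos r pq rr assms mult_mono[OF r(1) r(2)] by (intro frac_le) auto
    finally show ?thesis by simp
  qed
  then have "\<bar>q - p\<bar> * (1 / min p q) \<le> \<bar>v - u\<bar> * (1 / p + \<bar>v - u\<bar> / \<epsilon>)"
    using pos pq by (intro mult_mono) auto
  then have "\<bar>ln (v\<^sup>2 + \<epsilon>) - ln (u\<^sup>2 + \<epsilon>)\<bar> \<le> 2 * (\<bar>v - u\<bar> * (1 / p + \<bar>v - u\<bar> / \<epsilon>))"
    using le eq by linarith
  also have "\<dots> = (2 / p + 2 / \<epsilon> * \<bar>v - u\<bar>) * \<bar>v - u\<bar>"
    by (simp only: distrib_left distrib_right) simp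
  finally show "\<bar>ln (v\<^sup>2 + \<epsilon>) - ln (u\<^sup>2 + \<epsilon>)\<bar> \<le> (2 / sqrt (u\<^sup>2 + \<epsilon>) + 2 / \<epsilon> * \<bar>v - u\<bar>) * \<bar>v - u\<bar>"
    by (simp only: p_def)
qed

text \<open>The shift keeps the density away from 0, so its logarithm is Lipschitz; division by
  \<open>1 + \<epsilon>\<close> restores total mass 1. The factor 4 in the pointwise gradient bound
  turns \<open>a / 2\<close> into \<open>2 * a\<close>.\<close>

lemma entropy_le_grad_shift:
  fixes \<nu> :: "'a::metric_space measure" and f :: "'a \<Rightarrow> real"
  assumes cm: "compact_measured_length_space \<nu>" and Ricci: "infinity_Ricci_bounded_below \<nu> K"
    and L: "L-lipschitz_on UNIV f" and one: "(\<integral>x. (f x)\<^sup>2 \<partial>\<nu>) = 1" and a: "0 < a"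
    and B: "\<And>W. 0 \<le> W \<Longrightarrow> W \<le> diameter (UNIV :: 'a set) \<Longrightarrow> W\<^sup>2 * (1 / a - K) / 2 \<le> B"
    and \<epsilon>: "0 < \<epsilon>"
  shows "(\<integral>x. ent (((f x)\<^sup>2 + \<epsilon>) / (1 + \<epsilon>)) \<partial>\<nu>) \<le> 2 * a * (\<integral>x. (grad_norm f x)\<^sup>2 \<partial>\<nu>) + B"
proof -
  have comp: "compact (UNIV :: 'a set)" and \<nu>: "\<nu> \<in> P2"
    using cm by (auto simp: compact_measured_length_space_def)
  interpret N: prob_space \<nu> using \<nu> by (simp add: P2_def)
  have cont: "continuous_on UNIV f" using L by (rule lipschitz_on_continuous_on)
  have L0: "0 \<le> L" using L by (rule lipschitz_on_nonneg)
  define \<phi> where "\<phi> x = ln (((f x)\<^sup>2 + \<epsilon>) / (1 + \<epsilon>))" for x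
  have fpos: "0 < (f x)\<^sup>2 + \<epsilon>" for x using \<epsilon> by (simp add: add_nonneg_pos)
  have exp\<phi>: "exp (\<phi> x) = ((f x)\<^sup>2 + \<epsilon>) / (1 + \<epsilon>)" for x
    using fpos[of x] \<epsilon> by (simp add: \<phi>_def)
  have \<phi>_diff: "\<bar>\<phi> y - \<phi> x\<bar> = \<bar>ln ((f y)\<^sup>2 + \<epsilon>) - ln ((f x)\<^sup>2 + \<epsilon>)\<bar>" for x y
    using fpos[of x] fpos[of y] \<epsilon> by (simp add: \<phi>_def ln_div)
  have f_diff: "\<bar>f y - f x\<bar> \<le> L * dist x y" for x y
    using lipschitz_onD[OF L, of x y] by (simp add: dist_real_def abs_minus_commute)
  have L\<phi>: "(2 / sqrt \<epsilon> * L)-lipschitz_on UNIV \<phi>"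
  proof (rule lipschitz_onI)
    fix x y
    have "\<bar>\<phi> y - \<phi> x\<bar> \<le> 2 / sqrt \<epsilon> * \<bar>f y - f x\<bar>"
      unfolding \<phi>_diff by (rule ln_shift_diff_le(1)[OF \<epsilon>])
    also have "\<dots> \<le> 2 / sqrt \<epsilon> * (L * dist x y)" using \<epsilon> by (intro mult_left_mono f_diff) auto
    finally show "dist (\<phi> x) (\<phi> y) \<le> 2 / sqrt \<epsilon> * L * dist x y"
      by (simp add: dist_real_def abs_minus_commute)
  qed (use L0 \<epsilon> in auto)
  have chain: "grad_norm \<phi> x \<le> 2 / sqrt ((f x)\<^sup>2 + \<epsilon>) * grad_norm f x" for x
  proof (rule grad_norm_chain[OF L L\<phi>, where C = "2 / \<epsilon> * L"])
    fix y
    have "\<bar>\<phi> y - \<phi> x\<bar> \<le> (2 / sqrt ((f x)\<^sup>2 + \<epsilon>) + 2 / \<epsilon> * \<bar>f y - f x\<bar>) * \<bar>f y - f x\<bar>"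
      unfolding \<phi>_diff by (rule ln_shift_diff_le(2)[OF \<epsilon>])
    also have "\<dots> \<le> (2 / sqrt ((f x)\<^sup>2 + \<epsilon>) + 2 / \<epsilon> * (L * dist x y)) * \<bar>f y - f x\<bar>"
      using \<epsilon> by (intro mult_right_mono add_left_mono mult_left_mono f_diff) auto
    finally show "\<bar>\<phi> y - \<phi> x\<bar> \<le> (2 / sqrt ((f x)\<^sup>2 + \<epsilon>) + 2 / \<epsilon> * L * dist x y) * \<bar>f y - f x\<bar>"
      by (simp add: mult.assoc)
  qed (use fpos[of x] \<epsilon> L0 in auto)
  \<comment> \<open>The density cancels the denominator of the squared chain-rule factor
    \<open>4 / ((f x)\<^sup>2 + \<epsilon>)\<close>, so the bound is uniform in
    \<open>\<epsilon>\<close>.\<close>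
  have pointwise: "exp (\<phi> x) * (grad_norm \<phi> x)\<^sup>2 \<le> 4 * (grad_norm f x)\<^sup>2" for x
  proof -
    have "(grad_norm \<phi> x)\<^sup>2 \<le> (2 / sqrt ((f x)\<^sup>2 + \<epsilon>) * grad_norm f x)\<^sup>2"
      using chain grad_norm_bounds(1)[OF L\<phi>] by (rule power_mono)
    also have "\<dots> = 4 / ((f x)\<^sup>2 + \<epsilon>) * (grad_norm f x)\<^sup>2"
      using fpos[of x] by (simp add: power_mult_distrib power_divide)
    finally have "exp (\<phi> x) * (grad_norm \<phi> x)\<^sup>2 \<le> exp (\<phi> x) * (4 / ((f x)\<^sup>2 + \<epsilon>) * (grad_norm f x)\<^sup>2)"
      by (intro mult_left_mono) auto
    also have "\<dots> = 4 * (grad_norm f x)\<^sup>2 / (1 + \<epsilon>)"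
      using less_imp_neq[OF fpos[of x]] unfolding exp\<phi> by simp
    also have "\<dots> \<le> 4 * (grad_norm f x)\<^sup>2"
      using \<epsilon> by (simp add: divide_le_eq mult_left_mono mult_le_cancel_left1)
    finally show ?thesis .
  qed
  have cont\<phi>: "continuous_on UNIV \<phi>" using L\<phi> by (rule lipschitz_on_continuous_on)
  have "integrable \<nu> (\<lambda>x. (f x)\<^sup>2)"
    by (intro P2_integrable_continuous[OF comp \<nu>] continuous_intros cont)
  then have "(\<integral>x. exp (\<phi> x) \<partial>\<nu>) = 1" using one \<epsilon> by (simp add: exp\<phi> N.prob_space)
  note main = relative_entropy_le_grad[OF cm Ricci L\<phi> this a B]
  have "(\<integral>x. ent (((f x)\<^sup>2 + \<epsilon>) / (1 + \<epsilon>)) \<partial>\<nu>) = (\<integral>x. exp (\<phi> x) * \<phi> x \<partial>\<nu>)"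
    unfolding exp\<phi> by (simp add: ent_def \<phi>_def)
  also have "\<dots> \<le> a / 2 * (\<integral>x. exp (\<phi> x) * (grad_norm \<phi> x)\<^sup>2 \<partial>\<nu>) + B" by (rule main)
  also have "\<dots> \<le> a / 2 * (\<integral>x. 4 * (grad_norm f x)\<^sup>2 \<partial>\<nu>) + B"
  proof (intro add_right_mono mult_left_mono integral_mono pointwise)
    have gb: "\<bar>(grad_norm f x)\<^sup>2\<bar> \<le> L\<^sup>2" for x
      using grad_norm_bounds(1)[OF L, of x] grad_norm_le_lipschitz[OF L, of x] by (simp add: power_mono)
    have g4: "\<bar>4 * (grad_norm f x)\<^sup>2\<bar> \<le> 4 * L\<^sup>2" for x using gb[of x] by simp
    show "integrable \<nu> (\<lambda>x. 4 * (grad_norm f x)\<^sup>2)"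
      by (rule P2_integrable_bounded[OF \<nu> _ g4])
        (intro borel_measurable_times borel_measurable_power borel_measurable_grad_norm[OF L] borel_measurable_const)
    have g\<phi>: "\<bar>exp (\<phi> x) * (grad_norm \<phi> x)\<^sup>2\<bar> \<le> 4 * L\<^sup>2" for x
      using pointwise[of x] g4[of x] by (simp add: abs_mult)
    show "integrable \<nu> (\<lambda>x. exp (\<phi> x) * (grad_norm \<phi> x)\<^sup>2)"
      by (rule P2_integrable_bounded[OF \<nu> _ g\<phi>])
        (intro borel_measurable_times borel_measurable_power borel_measurable_grad_norm[OF L\<phi>]
          borel_measurable_continuous_onI continuous_intros cont\<phi>)
  qed (use a in auto)
  also have "\<dots> = 2 * a * (\<integral>x. (grad_norm f x)\<^sup>2 \<partial>\<nu>) + B" by simp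
  finally show ?thesis .
qed

text \<open>Let \<open>\<epsilon>\<close> tend to 0 in \<open>entropy_le_grad_shift\<close>, whose
  right side does not depend on \<open>\<epsilon>\<close>. Zeros of \<open>f\<close> cause no
  trouble because \<open>ent\<close> is continuous up to 0; its boundedness on a compact interval
  containing all densities gives the dominating constant.\<close>

lemma entropy_le_grad:
  fixes \<nu> :: "'a::metric_space measure" and f :: "'a \<Rightarrow> real"
  assumes cm: "compact_measured_length_space \<nu>" and Ricci: "infinity_Ricci_bounded_below \<nu> K"
    and L: "L-lipschitz_on UNIV f" and one: "(\<integral>x. (f x)\<^sup>2 \<partial>\<nu>) = 1" and a: "0 < a"
    and B: "\<And>W. 0 \<le> W \<Longrightarrow> W \<le> diameter (UNIV :: 'a set) \<Longrightarrow> W\<^sup>2 * (1 / a - K) / 2 \<le> B"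
  shows "(\<integral>x. ent ((f x)\<^sup>2) \<partial>\<nu>) \<le> 2 * a * (\<integral>x. (grad_norm f x)\<^sup>2 \<partial>\<nu>) + B"
proof -
  have comp: "compact (UNIV :: 'a set)" and \<nu>: "\<nu> \<in> P2"
    using cm by (auto simp: compact_measured_length_space_def)
  interpret N: prob_space \<nu> using \<nu> by (simp add: P2_def)
  have s: "sets \<nu> = sets borel" using \<nu> by (auto simp: P2_def)
  have cont: "continuous_on UNIV f" using L by (rule lipschitz_on_continuous_on)
  have f[measurable]: "f \<in> borel_measurable \<nu>"
    unfolding measurable_cong_sets[OF s refl] by (rule borel_measurable_continuous_onI[OF cont])
  have ent_m[measurable]: "ent \<in> borel_measurable borel" unfolding ent_def[abs_def] by measurable
  obtain M where M: "\<And>x. \<bar>f x\<bar> \<le> M"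
    using compact_imp_bounded[OF compact_continuous_image[OF cont comp]] by (auto simp: bounded_iff)
  have M2: "(f x)\<^sup>2 \<le> M\<^sup>2" for x using power_mono[OF M[of x], of 2] by simp
  have "compact (ent ` {0..M\<^sup>2 + 1})"
    by (intro compact_continuous_image continuous_on_subset[OF continuous_on_ent]) auto
  then have "bounded (ent ` {0..M\<^sup>2 + 1})" by (rule compact_imp_bounded)
  then obtain C where "\<forall>y\<in>ent ` {0..M\<^sup>2 + 1}. norm y \<le> C" unfolding bounded_iff by blast
  then have C: "\<bar>ent r\<bar> \<le> C" if "r \<in> {0..M\<^sup>2 + 1}" for r using that by auto
  define \<epsilon> where "\<epsilon> n = 1 / real (Suc n)" for n
  have \<epsilon>: "0 < \<epsilon> n" "\<epsilon> n \<le> 1" for n by (auto simp: \<epsilon>_def)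
  have \<epsilon>0: "\<epsilon> \<longlonglongrightarrow> 0" unfolding \<epsilon>_def using LIMSEQ_Suc[OF lim_inverse_n'] by simp
  define r where "r n x = ((f x)\<^sup>2 + \<epsilon> n) / (1 + \<epsilon> n)" for n x
  have r0: "0 \<le> r n x" for n x using \<epsilon>(1)[of n] by (simp add: r_def)
  have "r n x \<le> M\<^sup>2 + 1" for n x
  proof -
    have "r n x \<le> (f x)\<^sup>2 + \<epsilon> n"
      using \<epsilon>(1)[of n] divide_left_mono[of 1 "1 + \<epsilon> n" "(f x)\<^sup>2 + \<epsilon> n"] by (simp add: r_def)
    then show ?thesis using M2[of x] \<epsilon>(2)[of n] by simp
  qed
  then have bound: "\<bar>ent (r n x)\<bar> \<le> C" for n x using r0 by (intro C) auto
  have lim: "(\<lambda>n. ent (r n x)) \<longlonglongrightarrow> ent ((f x)\<^sup>2)" for x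
  proof (rule continuous_on_tendsto_compose[OF continuous_on_ent])
    have "(\<lambda>n. r n x) \<longlonglongrightarrow> ((f x)\<^sup>2 + 0) / (1 + 0)"
      unfolding r_def by (intro tendsto_intros \<epsilon>0) auto
    then show "(\<lambda>n. r n x) \<longlonglongrightarrow> (f x)\<^sup>2" by simp
  qed (use r0 in auto)
  have "(\<lambda>n. \<integral>x. ent (r n x) \<partial>\<nu>) \<longlonglongrightarrow> (\<integral>x. ent ((f x)\<^sup>2) \<partial>\<nu>)"
  proof (rule integral_dominated_convergence[where w = "\<lambda>_. C"])
    show "AE x in \<nu>. (\<lambda>n. ent (r n x)) \<longlonglongrightarrow> ent ((f x)\<^sup>2)" by (intro AE_I2 lim)
    show "AE x in \<nu>. norm (ent (r n x)) \<le> C" for n using bound by (intro AE_I2) simp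
    show "(\<lambda>x. ent (r n x)) \<in> borel_measurable \<nu>" for n unfolding r_def by measurable
  qed simp_all
  then show ?thesis
  proof (rule LIMSEQ_le_const2)
    show "\<exists>N. \<forall>n\<ge>N. (\<integral>x. ent (r n x) \<partial>\<nu>) \<le> 2 * a * (\<integral>x. (grad_norm f x)\<^sup>2 \<partial>\<nu>) + B"
      unfolding r_def by (intro exI allI impI entropy_le_grad_shift[OF cm Ricci L one a B \<epsilon>(1)])
  qed
qed

text \<open>The optimal parameter is \<open>a = D / (2 * sqrt I)\<close>, which is not a positive
  number to insert if \<open>D\<close> or \<open>I\<close> vanishes. Adding \<open>e\<close> to both
  \<open>D\<close> and \<open>sqrt I\<close> avoids the case distinction, and then \<open>e\<close>
  tends to 0.\<close>

lemma le_geometric_mean_of_young: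
  fixes x I D :: real
  assumes "0 \<le> I" "0 \<le> D" and le: "\<And>a. 0 < a \<Longrightarrow> x \<le> 2 * a * I + D\<^sup>2 / (2 * a)"
  shows "x \<le> 2 * D * sqrt I"
proof -
  define s where "s = sqrt I"
  have s: "0 \<le> s" "I = s * s" using assms by (auto simp: s_def)
  have "x \<le> (D + e) * s + D * (s + e)" if e: "0 < e" for e
  proof -
    define p q where "p = D + e" and "q = s + e"
    have p: "0 < p" "D \<le> p" and q: "0 < q" "s \<le> q" using e assms s by (auto simp: p_def q_def)
    \<comment> \<open>The optimal parameter for the perturbed values; the quotients
      \<open>s / q\<close> and \<open>D / p\<close> that remain are at most 1.\<close>
    have "x \<le> 2 * (p / (2 * q)) * I + D\<^sup>2 / (2 * (p / (2 * q)))"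
      using p q by (intro le) auto
    also have "\<dots> = p * s * (s / q) + D * q * (D / p)"
      using p q by (simp add: s(2) power2_eq_square field_simps)
    also have "\<dots> \<le> p * s * 1 + D * q * 1"
      using p q s assms by (intro add_mono mult_left_mono) auto
    finally show ?thesis by (simp add: p_def q_def)
  qed
  moreover have "((\<lambda>e. (D + e) * s + D * (s + e)) \<longlongrightarrow> (D + 0) * s + D * (s + 0)) (at_right 0)"
    by (intro tendsto_intros)
  ultimately have "x \<le> (D + 0) * s + D * (s + 0)"
    by (intro tendsto_lowerbound[OF _ _ trivial_limit_at_right_real])
      (auto simp: eventually_at_right_field intro!: exI[of _ 1])
  then show ?thesis by (simp add: s_def)
qed

theorem theorem0p16:
  fixes \<nu> :: "'a::metric_space measure" and f :: "'a \<Rightarrow> real" and K :: real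
  assumes "compact_measured_length_space \<nu>"
    and "infinity_Ricci_bounded_below \<nu> K"
    and "f \<in> Lip"
    and "(\<integral>x. (f x)\<^sup>2 \<partial>\<nu>) = 1"
  shows "(K > 0 \<longrightarrow>
      (\<integral>x. (f x)\<^sup>2 * ln ((f x)\<^sup>2) \<partial>\<nu>) \<le> 2 / K * (\<integral>x. (grad_norm f x)\<^sup>2 \<partial>\<nu>)) \<and>
    (K \<le> 0 \<longrightarrow>
      (\<integral>x. (f x)\<^sup>2 * ln ((f x)\<^sup>2) \<partial>\<nu>) \<le>
        2 * diameter (UNIV :: 'a set) * sqrt (\<integral>x. (grad_norm f x)\<^sup>2 \<partial>\<nu>)
        - 1/2 * K * (diameter (UNIV :: 'a set))\<^sup>2)"
proof (intro conjI impI)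
  obtain L where L: "L-lipschitz_on UNIV f" using assms(3) by (auto simp: Lip_def)
  let ?I = "\<integral>x. (grad_norm f x)\<^sup>2 \<partial>\<nu>" and ?D = "diameter (UNIV :: 'a set)"
  let ?H = "\<integral>x. (f x)\<^sup>2 * ln ((f x)\<^sup>2) \<partial>\<nu>"
  note bound = entropy_le_grad[OF assms(1,2) L assms(4), unfolded ent_def]
  {
    assume "K > 0"
    \<comment> \<open>With \<open>a = 1 / K\<close> the coefficient \<open>1 / a - K\<close> of the
      squared distance is zero, so \<open>B = 0\<close> is admissible.\<close>
    then show "?H \<le> 2 / K * ?I" using bound[of "1 / K" 0] by simp
  next
    assume K: "K \<le> 0"
    have D: "0 \<le> ?D"
      using dist_le_diameter[of "undefined :: 'a" undefined] assms(1)
      by (simp add: compact_measured_length_space_def)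
    have "?H + 1/2 * K * ?D\<^sup>2 \<le> 2 * a * ?I + ?D\<^sup>2 / (2 * a)" if a: "0 < a" for a
    proof -
      \<comment> \<open>This makes the coefficient \<open>1 / a - K\<close> nonnegative, so the
        transport term is largest when the distance equals the diameter.\<close>
      have "K \<le> 1 / a" using a by (intro order_trans[OF K]) simp
      then have "?H \<le> 2 * a * ?I + ?D\<^sup>2 * (1 / a - K) / 2"
        using a by (intro bound divide_right_mono mult_right_mono power_mono) auto
      also have "\<dots> = 2 * a * ?I + ?D\<^sup>2 / (2 * a) - 1/2 * K * ?D\<^sup>2"
        using a by (simp add: field_simps)
      finally show ?thesis by simp
    qed
    then have "?H + 1/2 * K * ?D\<^sup>2 \<le> 2 * ?D * sqrt ?I"
      using D by (intro le_geometric_mean_of_young) (auto intro: integral_nonneg_AE)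
    then show "?H \<le> 2 * ?D * sqrt ?I - 1/2 * K * ?D\<^sup>2" by simp
  }
qed

end
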